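(* Let $d<0$ be a square-free integer with $d\neq-1,-3$, and let $O_d$ be the ring of integers of $\mathbb Q(\sqrt d)$. Let $q\in\mathbb N$ be a prime such that $q$ is inert in $O_d$, or $q\ge5$ and $q$ is split in $O_d$. Then the Bianchi group $B_d=PSL(2,O_d)$ has a normal non-congruence subgroup of level $q$ and index $q$. Similarly, $PE_d$ has a normal non-congruence subgroup of level $q$ and index $q$.
   Context: Let $\{1,w\}$ be an integral basis of $O_d$. $PE_d=E_d/\langle\pm I\rangle$, where $E_d$ is the subgroup of $SL(2,O_d)$ generated by $\begin{pmatrix}1&1\\0&1\end{pmatrix}$, $\begin{pmatrix}1&w\\0&1\end{pmatrix}$, $\begin{pmatrix}0&1\\-1&0\end{pmatrix}$. Let $G$ be $B_d$ or $PE_d$. For a nonzero ideal $\pi$ of $O_d$, $G(\pi)=\{x\in G:x\equiv\pm I\pmod\pi\}$. A subgroup of $G$ is congruence if it contains $G(\pi)$ for some nonzero ideal $\pi\subseteq O_d$, and non-congruence otherwise. The level of a finite index subgroup $K$ of $G$ is the smallest positive integer $m$ such that the normal closure in $G$ of the subgroup generated by $\pm\begin{pmatrix}1&m\\0&1\end{pmatrix}$ and $\pm\begin{pmatrix}1&mw\\0&1\end{pmatrix}$ is contained in $K$. A rational prime $q$ is inert in $O_d$ if $(q)$ is a prime ideal, and split if $(q)$ is a product of two or more distinct prime ideals. *)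

theory Defs
  imports
    "HOL-Analysis.Analysis"
    "HOL-Computational_Algebra.Computational_Algebra"
    "HOL-Algebra.Generated_Groups"
    "HOL-Algebra.Ideal_Product"
begin

section \<open>Rings of integers of imaginary quadratic fields\<close>

text \<open>The field $\mathbb{Q}(\sqrt d)$ is realised inside the complex numbers.\<close>

definition quadratic_field :: "int \<Rightarrow> complex set" where
  "quadratic_field d = {of_rat a + of_rat b * csqrt (of_int d) | a b. True}"

definition integers_of :: "int \<Rightarrow> complex set" where
  "integers_of d = {x \<in> quadratic_field d. algebraic_int x}"

definition O_ring :: "int \<Rightarrow> complex ring" where
  "O_ring d = \<lparr>carrier = integers_of d, mult = (*), one = 1, zero = 0, add = (+)\<rparr>"

text \<open>\<open>{1, w}\<close> is a basis of the ring of integers as a free abelian group.\<close>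

definition integral_basis_1 :: "int \<Rightarrow> complex \<Rightarrow> bool" where
  "integral_basis_1 d w \<longleftrightarrow>
     bij_betw (\<lambda>(m, n). of_int m + of_int n * w) (UNIV :: (int \<times> int) set) (integers_of d)"

definition inert_in :: "int \<Rightarrow> nat \<Rightarrow> bool" where
  "inert_in d q \<longleftrightarrow> primeideal (PIdl\<^bsub>O_ring d\<^esub> (of_nat q)) (O_ring d)"

text \<open>The factors are pairwise distinct, so ramified primes are excluded.\<close>

definition split_in :: "int \<Rightarrow> nat \<Rightarrow> bool" where
  "split_in d q \<longleftrightarrow>
     (\<exists>Ps. length Ps \<ge> 2 \<and> distinct Ps \<and> (\<forall>P\<in>set Ps. primeideal P (O_ring d)) \<and>
           PIdl\<^bsub>O_ring d\<^esub> (of_nat q) = foldr (ideal_prod (O_ring d)) Ps (carrier (O_ring d)))"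


section \<open>Bianchi groups and their elementary subgroups\<close>

definition mat2 :: "complex \<Rightarrow> complex \<Rightarrow> complex \<Rightarrow> complex \<Rightarrow> complex^2^2" where
  "mat2 a b c e = vector [vector [a, b], vector [c, e]]"

definition SL2 :: "int \<Rightarrow> (complex^2^2) monoid" where
  "SL2 d = \<lparr>carrier = {A. det A = 1 \<and> (\<forall>i j. A $ i $ j \<in> integers_of d)},
            mult = (**), one = mat 1\<rparr>"

definition E2 :: "int \<Rightarrow> complex \<Rightarrow> (complex^2^2) monoid" where
  "E2 d w = (SL2 d)\<lparr>carrier :=
     generate (SL2 d) {mat2 1 1 0 1, mat2 1 w 0 1, mat2 0 1 (-1) 0}\<rparr>"

text \<open>Elements of the quotients below are the two-element cosets \<open>{A, -A}\<close>.\<close>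

definition Bianchi :: "int \<Rightarrow> (complex^2^2) set monoid" where
  "Bianchi d = SL2 d Mod {mat 1, - mat 1}"

definition PE2 :: "int \<Rightarrow> complex \<Rightarrow> (complex^2^2) set monoid" where
  "PE2 d w = E2 d w Mod {mat 1, - mat 1}"

definition pm :: "complex^2^2 \<Rightarrow> (complex^2^2) set" where
  "pm A = {A, - A}"


section \<open>Congruence subgroups and level\<close>

text \<open>In the following definitions \<open>G\<close> stands for \<^term>\<open>Bianchi d\<close> or \<^term>\<open>PE2 d w\<close>.\<close>

definition mat_cong :: "complex^2^2 \<Rightarrow> complex^2^2 \<Rightarrow> complex set \<Rightarrow> bool" where
  "mat_cong A B I \<longleftrightarrow> (\<forall>i j. A $ i $ j - B $ i $ j \<in> I)"

definition principal_congruence ::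
    "(complex^2^2) set monoid \<Rightarrow> complex set \<Rightarrow> (complex^2^2) set set" where
  "principal_congruence G I =
     {X \<in> carrier G. \<exists>A\<in>X. mat_cong A (mat 1) I \<or> mat_cong A (- mat 1) I}"

definition congruence_subgroup ::
    "int \<Rightarrow> (complex^2^2) set monoid \<Rightarrow> (complex^2^2) set set \<Rightarrow> bool" where
  "congruence_subgroup d G K \<longleftrightarrow> subgroup K G \<and>
     (\<exists>I. ideal I (O_ring d) \<and> I \<noteq> {0} \<and> principal_congruence G I \<subseteq> K)"

definition normal_closure :: "('a, 'b) monoid_scheme \<Rightarrow> 'a set \<Rightarrow> 'a set" where
  "normal_closure G S = \<Inter>{N. N \<lhd> G \<and> S \<subseteq> N}"

definition translation_closure ::
    "(complex^2^2) set monoid \<Rightarrow> complex \<Rightarrow> nat \<Rightarrow> (complex^2^2) set set" where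
  "translation_closure G w m =
     normal_closure G (generate G {pm (mat2 1 (of_nat m) 0 1), pm (mat2 1 (of_nat m * w) 0 1)})"

text \<open>A relation, so that no default value arises when no such \<open>m\<close> exists.\<close>

definition has_level ::
    "(complex^2^2) set monoid \<Rightarrow> complex \<Rightarrow> (complex^2^2) set set \<Rightarrow> nat \<Rightarrow> bool" where
  "has_level G w K m \<longleftrightarrow> m > 0 \<and> translation_closure G w m \<subseteq> K \<and>
     (\<forall>n. n > 0 \<and> translation_closure G w n \<subseteq> K \<longrightarrow> m \<le> n)"

definition index_of :: "('a, 'b) monoid_scheme \<Rightarrow> 'a set \<Rightarrow> nat" where
  "index_of G K = card (rcosets\<^bsub>G\<^esub> K)"

end

(*
  PSL(2, O) acts on hyperbolic 3-space, and the orbit of the hyperbolic plane over the real line is a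
  locally finite family of planes.  As long as no group element flips a plane (which uses that d is
  neither -1 nor -3), counting with signs the planes crossed on the way from a base point p to g p is
  a homomorphism to the integers.  It kills the translation by 1 and sends the translation by w to a
  generator, so its reduction modulo q cuts out normal subgroups of index q and level q, both in the
  Bianchi group and in its elementary subgroup.

  Such a subgroup is not a congruence subgroup: modulo any N, a Whitehead product conjugates the
  translation by x to the translation by l^2 x for a unit l modulo N.  If both l and l^2 - 1 have norm
  prime to q (l congruent to w if q is inert, to 2 if q >= 5), then some element congruent to the
  identity modulo N is not killed by the homomorphism modulo q.

  Planes are encoded by skew-Hermitian matrices, on which g acts by N |-> g^* N g; the plane over the
  real line is [[0, 1], [-1, 0]].  The side of N on which the base point (0, 1) lies is the sign of
  the trace.
*)

theory Submission
  imports Defs "HOL-Algebra.Elementary_Groups"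
begin

no_notation fps_nth (infixl "$" 75)

section \<open>Two-by-two matrices and the integral basis\<close>

lemma mat2_nth [simp]:
  "mat2 a b c e $ 1 $ 1 = a" "mat2 a b c e $ 1 $ 2 = b"
  "mat2 a b c e $ 2 $ 1 = c" "mat2 a b c e $ 2 $ 2 = e"
  by (simp_all add: mat2_def)

lemma mat2_eqI:
  assumes "A $ 1 $ 1 = B $ 1 $ 1" "A $ 1 $ 2 = B $ 1 $ 2" "A $ 2 $ 1 = B $ 2 $ 1" "A $ 2 $ 2 = B $ 2 $ 2"
  shows "A = (B :: complex^2^2)"
  using assms by (simp add: vec_eq_iff forall_2)

lemma mat2_eq_iff [simp]:
  "mat2 a b c e = mat2 a' b' c' e' \<longleftrightarrow> a = a' \<and> b = b' \<and> c = c' \<and> e = e'"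
  by (metis mat2_nth)

lemma mat2_cases:
  obtains a b c e where "A = mat2 a b c e"
  by (rule that[of "A $ 1 $ 1" "A $ 1 $ 2" "A $ 2 $ 1" "A $ 2 $ 2"]) (simp add: mat2_eqI)

lemma mat2_mult [simp]:
  "mat2 a b c e ** mat2 a' b' c' e' =
     mat2 (a * a' + b * c') (a * b' + b * e') (c * a' + e * c') (c * b' + e * e')"
  by (rule mat2_eqI) (simp_all add: matrix_matrix_mult_def sum_2)

lemma det_mat2 [simp]: "det (mat2 a b c e) = a * e - b * c"
  by (simp add: det_2)

lemma mat_1_eq_mat2: "mat 1 = mat2 1 0 0 1"
  by (rule mat2_eqI) (simp_all add: mat_def)

lemma uminus_mat2 [simp]: "- mat2 a b c e = mat2 (- a) (- b) (- c) (- e)"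
  by (rule mat2_eqI) simp_all

lemma matrix_mul_minus_left: "(- A) ** B = - (A ** B)" for A B :: "complex^2^2"
  by (cases A rule: mat2_cases, cases B rule: mat2_cases) simp

lemma matrix_mul_minus_right: "A ** (- B) = - (A ** B)" for A B :: "complex^2^2"
  by (cases A rule: mat2_cases, cases B rule: mat2_cases) simp

section \<open>The right action of matrices on forms\<close>

definition conj_transpose :: "complex^2^2 \<Rightarrow> complex^2^2" where
  "conj_transpose A = (\<chi> i j. cnj (A $ j $ i))"

lemma conj_transpose_mat2 [simp]:
  "conj_transpose (mat2 a b c e) = mat2 (cnj a) (cnj c) (cnj b) (cnj e)"
  by (rule mat2_eqI) (simp_all add: conj_transpose_def)

lemma conj_transpose_mult: "conj_transpose (A ** B) = conj_transpose B ** conj_transpose A"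
  by (cases A rule: mat2_cases, cases B rule: mat2_cases) (simp add: mult.commute)

text \<open>Pullback of a form: the base point lies relative to \<open>form_act N g\<close> as its
  image under \<open>g\<close> lies relative to \<open>N\<close>.\<close>

definition form_act :: "complex^2^2 \<Rightarrow> complex^2^2 \<Rightarrow> complex^2^2" where
  "form_act N g = conj_transpose g ** N ** g"

lemma form_act_mult: "form_act N (g ** h) = form_act (form_act N g) h"
  by (simp add: form_act_def conj_transpose_mult matrix_mul_assoc)

lemma form_act_mat_1 [simp]: "form_act N (mat 1) = N"
  by (cases N rule: mat2_cases) (simp add: form_act_def mat_1_eq_mat2)

lemma form_act_minus [simp]: "form_act N (- g) = form_act N g"
  by (cases N rule: mat2_cases, cases g rule: mat2_cases) (simp add: form_act_def algebra_simps)

text \<open>Gauss's lemma: the primitive integral minimal polynomial of \<open>x\<close> divides a monic one, so it is monic itself.\<close>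

lemma algebraic_int_quadratic:
  fixes x :: complex
  assumes "algebraic_int x" "Im x \<noteq> 0" "x + cnj x = of_int t" "x * cnj x \<in> \<rat>"
  shows "x * cnj x \<in> \<int>"
proof -
  obtain p :: "int poly" where p: "poly (map_poly of_int p) x = 0" "lead_coeff p = 1"
    using assms(1) unfolding algebraic_int_altdef_ipoly by auto
  obtain u v :: int where v: "v > 0" and cop: "coprime u v" and uv: "x * cnj x = of_int u / of_int v"
    using assms(4) by (auto elim: Rats_cases')
  \<comment> \<open>With \<open>u / v\<close> the norm of \<open>x\<close> in lowest terms, this is
    \<open>v\<close> times the quadratic polynomial of \<open>x\<close>; it is primitive because
    \<open>u\<close> and \<open>v\<close> are coprime.\<close>
  define g :: "int poly" where "g = [:u, - t * v, v:]"
  have g0: "g \<noteq> 0" and degg: "degree g = 2" and lcg: "lead_coeff g = v" using v by (auto simp: g_def)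
  have cg: "content g = 1"
  proof -
    have "content g dvd coeff g 0" "content g dvd coeff g 2"
      by simp_all
    hence "content g dvd u" "content g dvd v" by (auto simp: g_def numeral_2_eq_2)
    hence "is_unit (content g)" using cop coprime_common_divisor by blast
    thus ?thesis by (metis normalize_content is_unit_normalize)
  qed
  have gx: "poly (map_poly of_int g) x = 0"
  proof -
    have "poly (map_poly of_int g) x = of_int v * (of_int u / of_int v - of_int t * x + x * x)"
      using v by (simp add: g_def map_poly_pCons field_simps)
    also have "\<dots> = 0" unfolding uv[symmetric] assms(3)[symmetric] by (simp add: algebra_simps)
    finally show ?thesis .
  qed
  \<comment> \<open>Pseudo-division over the integers divides \<open>p\<close> only up to a nonzero
    factor \<open>a\<close>, which a comparison of contents removes below.\<close>
  obtain a q where a: "a \<noteq> 0" and pm: "smult a p = g * q + pseudo_mod p g"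
    using pseudo_mod(1)[OF g0] by blast
  define r where "r = pseudo_mod p g"
  have "r = 0 \<or> degree r < degree g" unfolding r_def by (rule pseudo_mod(2)[OF g0])
  hence degr: "degree r < 2" using degg by auto
  let ?c = "map_poly of_int :: int poly \<Rightarrow> complex poly"
  have hom: "?c (f * h) = ?c f * ?c h" "?c (f + h) = ?c f + ?c h" "?c (smult a f) = smult (of_int a) (?c f)" for f h
    by (rule poly_eqI, simp add: coeff_map_poly coeff_mult)+
  have "poly (?c r) x = 0"
    using arg_cong[OF pm[folded r_def], of "\<lambda>f. poly (?c f) x"] p(1) gx by (simp add: hom)
  moreover have r: "r = [:coeff r 0, coeff r 1:]"
    using degr by (intro poly_eqI) (auto simp: coeff_pCons coeff_eq_0 split: nat.splits)
  ultimately have "poly (?c [:coeff r 0, coeff r 1:]) x = 0" by metis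
  hence rx: "of_int (coeff r 0) + x * of_int (coeff r 1) = 0"
    by (simp add: map_poly_pCons)
  \<comment> \<open>An integral linear relation for the nonreal number \<open>x\<close> is trivial:
    the imaginary part kills one coefficient, then the other vanishes too.\<close>
  hence "coeff r 1 = 0" using assms(2) by (auto simp: complex_eq_iff)
  moreover from this rx have "coeff r 0 = 0" by simp
  ultimately have "r = 0" using r by simp
  hence ap: "smult a p = g * q" using pm r_def by simp
  have "content p = 1"
    using p(2) by (metis content_dvd_coeff is_unit_normalize normalize_content)
  hence "content q = normalize a"
    using arg_cong[OF ap, of content] cg by (simp add: content_mult)
  hence "[:a:] dvd q" by (simp add: const_poly_dvd_iff_dvd_content)
  then obtain q' where "q = smult a q'" by (auto elim: dvdE)
  hence "smult a (p - g * q') = 0" using ap by (simp add: smult_diff_right)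
  hence "p = g * q'" using a by simp
  hence "v * lead_coeff q' = 1" using p(2) lcg by (simp add: lead_coeff_mult)
  hence "v = 1" using v by (simp add: zmult_eq_1_iff)
  thus ?thesis using uv by simp
qed


section \<open>The quadratic field and its integral basis\<close>

lemma of_real_of_rat: "of_real (of_rat a) = (of_rat a :: 'a :: real_field)"
  by (cases a) (simp add: of_rat_rat)

lemma quadratic_field_iff:
  assumes "d < 0"
  shows "x \<in> quadratic_field d \<longleftrightarrow>
    (\<exists>a b. x = Complex (real_of_rat a) (real_of_rat b * sqrt (- real_of_int d)))"
proof -
  have cs: "csqrt (of_int d) = \<i> * of_real (sqrt (- real_of_int d))"
    using assms csqrt_of_real_nonpos[of "real_of_int d"] by simp
  have "of_rat a + of_rat b * csqrt (of_int d) =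
    Complex (real_of_rat a) (real_of_rat b * sqrt (- real_of_int d))" for a b
    unfolding cs by (simp add: complex_eq_iff of_real_of_rat[where 'a = complex, symmetric])
  thus ?thesis by (simp add: quadratic_field_def)
qed

lemma integers_of_basis:
  assumes "integral_basis_1 d w"
  shows "x \<in> integers_of d \<longleftrightarrow> (\<exists>m n. x = of_int m + of_int n * w)"
proof -
  have "integers_of d = range (\<lambda>(m, n). of_int m + of_int n * w)"
    using assms by (auto simp: integral_basis_1_def bij_betw_def)
  thus ?thesis by auto
qed

text \<open>The number \<open>4 N - t^2 = 4 (Im w)^2\<close> is minus the discriminant. It is
  positive and congruent to 0 or 3 modulo 4, so if the bound failed it would be 3 or 4, which forces
  \<open>d = -3\<close> or \<open>d = -1\<close>.\<close>

lemma integral_basis_properties: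
  assumes d: "d < 0" "squarefree d" "d \<noteq> -1" "d \<noteq> -3" and w: "integral_basis_1 d w"
  shows "(Im w)\<^sup>2 > 1" "\<exists>t. w + cnj w = of_int t" "\<exists>N. w * cnj w = of_int N"
proof -
  note O = integers_of_basis[OF w]
  \<comment> \<open>Expressing the square root of \<open>d\<close> in the arbitrary basis links
    \<open>d\<close> with \<open>Im w\<close>.\<close>
  have "csqrt (of_int d) \<in> integers_of d"
  proof -
    have "algebraic_int (csqrt (of_int d))"
      by (intro algebraic_int_csqrt int_imp_algebraic_int) simp
    moreover have "csqrt (of_int d) = of_rat 0 + of_rat 1 * csqrt (of_int d)" by simp
    ultimately show ?thesis unfolding integers_of_def quadratic_field_def by blast
  qed
  then obtain m n where mn: "csqrt (of_int d) = of_int m + of_int n * w" using O by auto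
  have "Im (csqrt (of_int d)) = sqrt (- real_of_int d)"
    using d(1) csqrt_of_real_nonpos[of "real_of_int d"] by simp
  hence imw: "sqrt (- real_of_int d) = of_int n * Im w" unfolding mn by simp
  hence imw0: "Im w \<noteq> 0" using d(1) by auto
  have wO: "w \<in> integers_of d" unfolding O by (rule exI[of _ 0], rule exI[of _ 1]) simp
  obtain a b where ab: "w = Complex (real_of_rat a) (real_of_rat b * sqrt (- real_of_int d))"
    using wO d(1) by (auto simp: integers_of_def quadratic_field_iff)
  have "cnj w = Complex (real_of_rat a) (real_of_rat (- b) * sqrt (- real_of_int d))"
    by (simp add: ab complex_eq_iff of_rat_minus)
  hence "cnj w \<in> quadratic_field d" unfolding quadratic_field_iff[OF d(1)] by blast
  moreover have "algebraic_int (cnj w)" using wO by (simp add: integers_of_def)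
  ultimately have "cnj w \<in> integers_of d" by (simp add: integers_of_def)
  \<comment> \<open>Comparing imaginary parts gives \<open>k = -1\<close>, so the trace of
    \<open>w\<close> is the integer \<open>t\<close>.\<close>
  then obtain t k where tk: "cnj w = of_int t + of_int k * w" using O by auto
  have "- Im w = of_int k * Im w" using arg_cong[OF tk, of Im] by simp
  hence "of_int (k + 1) * Im w = 0" by (simp add: algebra_simps)
  hence "k = -1" using imw0 by (simp only: mult_eq_0_iff of_int_eq_0_iff) simp
  with tk have t: "w + cnj w = of_int t" by simp
  thus "\<exists>t. w + cnj w = of_int t" ..
  have "w * cnj w = of_rat (a\<^sup>2 + b\<^sup>2 * of_int (- d))"
  proof -
    have "w * cnj w = of_real ((real_of_rat a)\<^sup>2 + (real_of_rat b * sqrt (- real_of_int d))\<^sup>2)"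
      by (simp add: complex_mult_cnj ab)
    also have "\<dots> = of_real (real_of_rat (a\<^sup>2 + b\<^sup>2 * of_int (- d)))"
      using d(1) by (simp add: power_mult_distrib of_rat_add of_rat_diff of_rat_mult of_rat_power)
    finally show ?thesis by (simp only: of_real_of_rat)
  qed
  hence "w * cnj w \<in> \<rat>" by simp
  hence "w * cnj w \<in> \<int>"
    using algebraic_int_quadratic[OF _ imw0 t] wO by (simp add: integers_of_def)
  then obtain N where N: "w * cnj w = of_int N" by (auto elim: Ints_cases)
  thus "\<exists>N. w * cnj w = of_int N" by blast
  have E: "4 * (Im w)\<^sup>2 = of_int (4 * N - t\<^sup>2)"
  proof -
    have "2 * Re w = of_int t" using arg_cong[OF t, of Re] by simp
    hence "(2 * Re w)\<^sup>2 = (of_int t)\<^sup>2" by simp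
    hence "4 * (Re w)\<^sup>2 = (of_int t)\<^sup>2" by (simp add: power_mult_distrib)
    moreover have "(Re w)\<^sup>2 + (Im w)\<^sup>2 = of_int N"
      using arg_cong[OF N, of Re] by (simp add: power2_eq_square)
    ultimately show ?thesis by simp
  qed
  have "- real_of_int d = (of_int n)\<^sup>2 * (Im w)\<^sup>2"
    using arg_cong[OF imw, of "\<lambda>x. x\<^sup>2"] d(1) by (simp add: power_mult_distrib)
  hence "real_of_int (- 4 * d) = of_int (n\<^sup>2 * (4 * N - t\<^sup>2))"
    unfolding of_int_mult E[symmetric] by simp
  hence dE: "- 4 * d = n\<^sup>2 * (4 * N - t\<^sup>2)" by (simp only: of_int_eq_iff)
  show "(Im w)\<^sup>2 > 1"
  proof (rule ccontr)
    assume "\<not> (Im w)\<^sup>2 > 1"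
    hence "4 * N - t\<^sup>2 \<le> 4" using E by linarith
    moreover have "4 * N - t\<^sup>2 > 0" using E imw0 
    proof -
      have "real_of_int (4 * N - t\<^sup>2) > 0" unfolding E[symmetric] using imw0 by simp
      thus ?thesis by (simp only: of_int_0_less_iff)
    qed
    moreover have "t\<^sup>2 mod 4 = 0 \<or> t\<^sup>2 mod 4 = 1"
    proof (cases "even t")
      case True
      then obtain b where "t = 2 * b" by (elim evenE)
      hence "t\<^sup>2 = 4 * b\<^sup>2" by simp
      thus ?thesis by presburger
    next
      case False
      then obtain b where "t = 2 * b + 1" by (elim oddE)
      hence "t\<^sup>2 = 4 * (b\<^sup>2 + b) + 1" by (simp add: power2_eq_square algebra_simps)
      thus ?thesis by presburger
    qed
    ultimately have "4 * N - t\<^sup>2 = 3 \<or> 4 * N - t\<^sup>2 = 4" by presburger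
    \<comment> \<open>In both cases \<open>-4 d = n^2 (4 N - t^2)\<close> exhibits a square factor
      of \<open>d\<close>, which squarefreeness reduces to 1.\<close>
    thus False
    proof
      assume 4: "4 * N - t\<^sup>2 = 4"
      hence dn: "d = - (n\<^sup>2)" using dE by simp
      hence "n\<^sup>2 dvd d" by simp
      hence "\<bar>n\<bar> = 1" using d(2) by (auto simp: squarefree_def)
      hence "n\<^sup>2 = 1" by (metis power2_abs one_power2)
      thus False using dn d(3) by simp
    next
      assume 3: "4 * N - t\<^sup>2 = 3"
      have "even (n\<^sup>2 * 3)" unfolding dE[unfolded 3, symmetric] by simp
      then obtain k where k: "n = 2 * k" by (auto elim: evenE)
      hence dk: "d = - (3 * k\<^sup>2)" using dE 3 by (simp add: power2_eq_square)
      hence "k\<^sup>2 dvd d" by simp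
      hence "\<bar>k\<bar> = 1" using d(2) by (auto simp: squarefree_def)
      hence "k\<^sup>2 = 1" by (metis power2_abs one_power2)
      thus False using dk d(4) by simp
    qed
  qed
qed

section \<open>Forms attached to an imaginary quadratic order\<close>

text \<open>The last assumption says that the discriminant \<open>-4 (Im w)^2\<close> is below -4;
  in this form the exclusion of \<open>d = -1\<close> and \<open>d = -3\<close> enters the
  geometry.\<close>

locale imaginary_order =
  fixes d :: int and w :: complex and t n0 :: int
  assumes integers_of_iff: "x \<in> integers_of d \<longleftrightarrow> (\<exists>m n. x = of_int m + of_int n * w)"
    and trace_w: "w + cnj w = of_int t"
    and norm_w: "w * cnj w = of_int n0"
    and Im_w: "(Im w)\<^sup>2 > 1"
begin

abbreviation Od :: "complex set" where "Od \<equiv> integers_of d"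

section \<open>Arithmetic of the order\<close>

lemma Im_w_nz [simp]: "Im w \<noteq> 0"
  using Im_w by auto

lemma of_int_in_O [simp, intro]: "of_int m \<in> Od"
  unfolding integers_of_iff by (rule exI[of _ m], rule exI[of _ 0]) simp

lemma O_basic [simp, intro]: "0 \<in> Od" "1 \<in> Od" "-1 \<in> Od" "of_nat k \<in> Od" "numeral v \<in> Od"
  using of_int_in_O[of 0] of_int_in_O[of 1] of_int_in_O[of "-1"] of_int_in_O[of "int k"]
    of_int_in_O[of "numeral v"] by simp_all

lemma w_in_O [simp, intro]: "w \<in> Od"
  unfolding integers_of_iff by (rule exI[of _ 0], rule exI[of _ 1]) simp

lemma O_add [simp, intro]: assumes "x \<in> Od" "y \<in> Od" shows "x + y \<in> Od"
proof -
  obtain m n m' n' where "x = of_int m + of_int n * w" "y = of_int m' + of_int n' * w"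
    using assms by (auto simp: integers_of_iff)
  hence "x + y = of_int (m + m') + of_int (n + n') * w" by (simp add: algebra_simps)
  thus ?thesis unfolding integers_of_iff by blast
qed

lemma w_squared: "w * w = of_int (- n0) + of_int t * w"
  unfolding of_int_minus norm_w[symmetric] trace_w[symmetric] by (simp add: algebra_simps)

lemma O_mult [simp, intro]: assumes "x \<in> Od" "y \<in> Od" shows "x * y \<in> Od"
proof -
  obtain m n m' n' where "x = of_int m + of_int n * w" "y = of_int m' + of_int n' * w"
    using assms by (auto simp: integers_of_iff)
  hence "x * y = of_int (m * m') + of_int (m * n' + m' * n) * w + of_int (n * n') * (w * w)"
    by (simp add: algebra_simps)
  also have "\<dots> = of_int (m * m' - n * n' * n0) + of_int (m * n' + m' * n + n * n' * t) * w"
    unfolding w_squared by (simp add: algebra_simps)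
  finally show ?thesis unfolding integers_of_iff by blast
qed

lemma O_uminus [simp, intro]: "x \<in> Od \<Longrightarrow> - x \<in> Od"
  using O_mult[of "-1" x] by simp

lemma O_diff [simp, intro]: "x \<in> Od \<Longrightarrow> y \<in> Od \<Longrightarrow> x - y \<in> Od"
  using O_add[of x "- y"] by simp

lemma cnj_w: "cnj w = of_int t - w"
  using trace_w by (simp add: algebra_simps)

lemma O_cnj [simp, intro]: assumes "x \<in> Od" shows "cnj x \<in> Od"
proof -
  obtain m n where "x = of_int m + of_int n * w"
    using assms by (auto simp: integers_of_iff)
  hence "cnj x = of_int m + of_int n * (of_int t - w)" by (simp add: cnj_w)
  thus ?thesis by simp
qed

lemma O_real: assumes "x \<in> Od" "Im x = 0" shows "\<exists>m. x = of_int m"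
  using assms by (auto simp: integers_of_iff)

lemma O_norm: "x \<in> Od \<Longrightarrow> \<exists>m. x * cnj x = of_int m"
  by (rule O_real) auto

lemma basis_unique:
  assumes "of_int m + of_int n * w = of_int m' + of_int n' * w"
  shows "m = m'" "n = n'"
proof -
  show "n = n'" using arg_cong[OF assms, of Im] by simp
  with assms show "m = m'" by simp
qed

text \<open>A square root of the discriminant; conjugation acts trivially on \<open>Od\<close>
  modulo \<open>s\<close>.\<close>

definition s :: complex where "s = w - cnj w"

lemma s_eq: "s = Complex 0 (2 * Im w)"
  by (simp add: s_def complex_eq_iff)

lemma s_nz [simp]: "s \<noteq> 0"
  by (simp add: s_eq complex_eq_iff)

lemma cnj_s [simp]: "cnj s = - s"
  by (simp add: s_eq complex_eq_iff)

lemma s_mult_s: "s * s = - of_real (4 * (Im w)\<^sup>2)"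
  by (simp add: s_eq complex_eq_iff power2_eq_square)

lemma s_in_O [simp, intro]: "s \<in> Od"
  by (simp add: s_def)

lemma diff_cnj: assumes "x \<in> Od" shows "\<exists>k. x - cnj x = of_int k * s"
proof -
  obtain m n where "x = of_int m + of_int n * w"
    using assms by (auto simp: integers_of_iff)
  hence "x - cnj x = of_int n * s" by (simp add: s_def algebra_simps)
  thus ?thesis ..
qed

lemma finite_O_bounded: "finite {x \<in> Od. cmod x \<le> R}"
proof -
  define M where "M = \<lceil>R\<rceil>"
  define M' where "M' = \<lceil>R + R * cmod w\<rceil>"
  have "{x \<in> Od. cmod x \<le> R} \<subseteq> (\<lambda>(m, n). of_int m + of_int n * w) ` ({-M'..M'} \<times> {-M..M})"
  proof
    fix x assume "x \<in> {x \<in> Od. cmod x \<le> R}"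
    hence x: "x \<in> Od" "cmod x \<le> R" by auto
    then obtain m n where mn: "x = of_int m + of_int n * w" by (auto simp: integers_of_iff)
    \<comment> \<open>The imaginary part of \<open>x\<close> bounds \<open>n\<close>; subtracting
      \<open>n w\<close> then bounds \<open>m\<close>.\<close>
    have "1 \<le> \<bar>Im w\<bar>" using Im_w abs_square_le_1[of "Im w"] by linarith
    hence "\<bar>of_int n\<bar> \<le> \<bar>of_int n\<bar> * \<bar>Im w\<bar>" by (simp add: mult_le_cancel_left1)
    also have "\<dots> = \<bar>Im x\<bar>" by (simp add: mn abs_mult)
    also have "\<dots> \<le> R" using abs_Im_le_cmod[of x] x by simp
    finally have n: "\<bar>of_int n\<bar> \<le> R" .
    have "\<bar>of_int m\<bar> = cmod (x - of_int n * w)" by (simp add: mn)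
    also have "\<dots> \<le> cmod x + \<bar>of_int n\<bar> * cmod w"
      by (rule order_trans[OF norm_triangle_ineq4]) (simp add: norm_mult)
    also have "\<dots> \<le> R + R * cmod w" using x n by (intro add_mono mult_right_mono) auto
    finally have m: "\<bar>of_int m\<bar> \<le> R + R * cmod w" .
    have "\<bar>n\<bar> \<le> M" "\<bar>m\<bar> \<le> M'" unfolding M_def M'_def using n m by linarith+
    hence "(m, n) \<in> {-M'..M'} \<times> {-M..M}" by auto
    thus "x \<in> (\<lambda>(m, n). of_int m + of_int n * w) ` ({-M'..M'} \<times> {-M..M})"
      unfolding mn by force
  qed
  thus ?thesis by (rule finite_subset) simp
qed

section \<open>The special linear group and the orbit of the real plane\<close>

definition SL :: "(complex^2^2) set" where
  "SL = {A. det A = 1 \<and> (\<forall>i j. A $ i $ j \<in> Od)}"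

lemma mat2_in_SL [simp]:
  "mat2 a b c e \<in> SL \<longleftrightarrow> a * e - b * c = 1 \<and> a \<in> Od \<and> b \<in> Od \<and> c \<in> Od \<and> e \<in> Od"
  by (auto simp: SL_def forall_2)

lemma SL_cases:
  assumes "A \<in> SL"
  obtains a b c e where "A = mat2 a b c e" "a * e - b * c = 1" "a \<in> Od" "b \<in> Od" "c \<in> Od" "e \<in> Od"
  using assms by (cases A rule: mat2_cases) auto

lemma SL_mult: assumes "A \<in> SL" "B \<in> SL" shows "A ** B \<in> SL"
proof -
  have "det (A ** B) = 1" using assms by (simp add: SL_def det_mul)
  thus ?thesis using assms
    by (elim SL_cases) (auto simp del: det_mat2 simp: SL_def forall_2)
qed

lemma SL_one: "mat 1 \<in> SL"
  by (simp add: mat_1_eq_mat2)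

lemma SL_inverse: assumes "A \<in> SL" shows "\<exists>B\<in>SL. B ** A = mat 1 \<and> A ** B = mat 1"
proof -
  obtain a b c e where A: "A = mat2 a b c e" "a * e - b * c = 1" "a \<in> Od" "b \<in> Od" "c \<in> Od" "e \<in> Od"
    using assms by (rule SL_cases)
  show ?thesis
    by (rule bexI[of _ "mat2 e (- b) (- c) a"]) (use A in \<open>auto simp: mat_1_eq_mat2 algebra_simps\<close>)
qed

text \<open>Planes with an orientation: \<open>N\<close> and \<open>- N\<close> would be the same
  plane with its sides exchanged.\<close>

definition forms :: "(complex^2^2) set" where
  "forms = form_act (mat2 0 1 (-1) 0) ` SL"

lemma form_act_in_forms: "N \<in> forms \<Longrightarrow> g \<in> SL \<Longrightarrow> form_act N g \<in> forms"
  unfolding forms_def by (auto simp: form_act_mult[symmetric] intro: SL_mult)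

lemma bij_form_act: assumes "g \<in> SL" shows "bij_betw (\<lambda>N. form_act N g) forms forms"
proof -
  obtain h where h: "h \<in> SL" "h ** g = mat 1" "g ** h = mat 1" using SL_inverse[OF assms] by blast
  show ?thesis
    by (rule bij_betw_byWitness[where f' = "\<lambda>N. form_act N h"])
      (auto simp: form_act_mult[symmetric] h assms intro: form_act_in_forms)
qed

lemma form_act_base:
  "form_act (mat2 0 1 (-1) 0) (mat2 a b c e) =
     mat2 (cnj a * c - cnj c * a) (cnj a * e - cnj c * b) (cnj b * c - cnj e * a) (cnj b * e - cnj e * b)"
  by (simp add: form_act_def algebra_simps)

text \<open>The diagonal entries are of the form \<open>x - cnj x\<close>. Conjugation is trivial
  modulo \<open>s\<close>, so the upper right entry is congruent to
  \<open>a * e - b * c = 1\<close>. As \<open>s\<close> does not divide 2, this congruence rules out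
  that \<open>- N\<close> occurs as well. The last equation is \<open>det N = 1\<close>.\<close>

lemma forms_shape:
  assumes "N \<in> forms"
  obtains A C :: int and y where "y \<in> Od"
    "N = mat2 (of_int A * s) (1 + s * y) (- cnj (1 + s * y)) (of_int C * s)"
    "(cmod (1 + s * y))\<^sup>2 = 1 + 4 * (Im w)\<^sup>2 * of_int A * of_int C"
proof -
  obtain a b c e where g: "N = form_act (mat2 0 1 (-1) 0) (mat2 a b c e)" "a * e - b * c = 1"
    "a \<in> Od" "b \<in> Od" "c \<in> Od" "e \<in> Od"
    using assms unfolding forms_def by (auto elim!: SL_cases)
  obtain A where A: "cnj a * c - cnj (cnj a * c) = of_int A * s" using diff_cnj[of "cnj a * c"] g by auto
  obtain C where C: "cnj b * e - cnj (cnj b * e) = of_int C * s" using diff_cnj[of "cnj b * e"] g by auto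
  obtain k where k: "a - cnj a = of_int k * s" using diff_cnj[of a] g by auto
  obtain l where l: "c - cnj c = of_int l * s" using diff_cnj[of c] g by auto
  define y where "y = of_int l * b - of_int k * e"
  have y: "y \<in> Od" using g by (simp add: y_def)
  have "cnj a * e - cnj c * b = (a * e - b * c) - (a - cnj a) * e + (c - cnj c) * b"
    by (simp add: algebra_simps)
  also have "\<dots> = 1 + s * y" unfolding k l g(2) by (simp add: y_def algebra_simps)
  finally have B: "cnj a * e - cnj c * b = 1 + s * y" .
  have B': "cnj b * c - cnj e * a = - cnj (1 + s * y)"
    unfolding B[symmetric] by (simp add: algebra_simps)
  have N: "N = mat2 (of_int A * s) (1 + s * y) (- cnj (1 + s * y)) (of_int C * s)"
    unfolding g(1) form_act_base B B' A[symmetric] C[symmetric] by (simp add: algebra_simps)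
  have "det N = cnj (a * e - b * c) * (a * e - b * c)"
    unfolding g(1) form_act_base by (simp add: algebra_simps)
  hence "det N = 1" unfolding g(2) by simp
  hence "of_int A * of_int C * (s * s) + (1 + s * y) * cnj (1 + s * y) = 1"
    unfolding N by (simp add: algebra_simps)
  hence "of_int A * of_int C * (- of_real (4 * (Im w)\<^sup>2)) + of_real ((cmod (1 + s * y))\<^sup>2) = (1 :: complex)"
    unfolding s_mult_s complex_norm_square by simp
  hence "of_real (- (of_int A * of_int C * (4 * (Im w)\<^sup>2)) + (cmod (1 + s * y))\<^sup>2) = (of_real 1 :: complex)"
    by simp
  hence "- (of_int A * of_int C * (4 * (Im w)\<^sup>2)) + (cmod (1 + s * y))\<^sup>2 = 1"
    by (simp only: of_real_eq_iff)
  thus ?thesis using that[OF y N] by (simp add: algebra_simps)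
qed

text \<open>The trace of a skew-Hermitian matrix divided by \<open>s\<close>; the division makes the
  result independent of the sign of \<open>Im w\<close>.\<close>

definition height :: "complex^2^2 \<Rightarrow> real" where
  "height N = Im (N $ 1 $ 1 + N $ 2 $ 2) / (2 * Im w)"

text \<open>The trace of \<open>g^* N g\<close> is that of \<open>N g g^*\<close>, so
  \<open>g\<close> enters only through the Gram matrix of its rows.\<close>

lemma height_form_act:
  "height (form_act (mat2 (of_int A * s) \<beta> (- cnj \<beta>) (of_int C * s)) (mat2 a b c e)) =
     of_int A * ((cmod a)\<^sup>2 + (cmod b)\<^sup>2) + of_int C * ((cmod c)\<^sup>2 + (cmod e)\<^sup>2)
     + Im (\<beta> * (cnj a * c + cnj b * e)) / Im w"
proof -
  have *: "form_act (mat2 (of_int A * s) \<beta> (- cnj \<beta>) (of_int C * s)) (mat2 a b c e) $ 1 $ 1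
    + form_act (mat2 (of_int A * s) \<beta> (- cnj \<beta>) (of_int C * s)) (mat2 a b c e) $ 2 $ 2
    = of_int A * s * (a * cnj a + b * cnj b) + of_int C * s * (c * cnj c + e * cnj e)
     + (\<beta> * (cnj a * c + cnj b * e) - cnj (\<beta> * (cnj a * c + cnj b * e)))"
    by (simp add: form_act_def algebra_simps)
  show ?thesis unfolding height_def * cmod_power2 by (simp add: s_eq field_simps power2_eq_square)
qed

lemma height_shape [simp]:
  "height (mat2 (of_int A * s) \<beta> \<gamma> (of_int C * s)) = of_int A + of_int C"
  by (simp add: height_def s_eq field_simps)

text \<open>If the integer \<open>A * C\<close> were negative, the right-hand side would be
  negative, because \<open>4 (Im w)^2 > 1\<close>.\<close>

lemma forms_AC_nonneg:
  assumes "(cmod \<beta>)\<^sup>2 = 1 + 4 * (Im w)\<^sup>2 * of_int A * of_int C"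
  shows "A * C \<ge> 0"
proof (rule ccontr)
  assume "\<not> A * C \<ge> 0"
  hence "real_of_int (A * C) \<le> -1" by linarith
  hence "4 * (Im w)\<^sup>2 * real_of_int (A * C) \<le> 4 * (Im w)\<^sup>2 * (-1)"
    by (intro mult_left_mono) auto
  moreover have "0 \<le> 1 + 4 * (Im w)\<^sup>2 * real_of_int (A * C)"
    using assms zero_le_power2[of "cmod \<beta>"] by (simp add: mult.assoc)
  ultimately show False using Im_w by linarith
qed

end

section \<open>The signed crossing number\<close>

lemma column_gram:
  fixes a b c e :: complex
  assumes "a * e - b * c = 1"
  shows "((cmod a)\<^sup>2 + (cmod b)\<^sup>2) * ((cmod c)\<^sup>2 + (cmod e)\<^sup>2) = 1 + (cmod (cnj a * c + cnj b * e))\<^sup>2"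
proof -
  have "complex_of_real (((cmod a)\<^sup>2 + (cmod b)\<^sup>2) * ((cmod c)\<^sup>2 + (cmod e)\<^sup>2)) =
      (a * e - b * c) * cnj (a * e - b * c) + (cnj a * c + cnj b * e) * cnj (cnj a * c + cnj b * e)"
    by (simp only: of_real_mult of_real_add complex_norm_square) (simp add: algebra_simps)
  also have "\<dots> = complex_of_real (1 + (cmod (cnj a * c + cnj b * e))\<^sup>2)"
    unfolding assms by (simp only: of_real_add complex_norm_square) simp
  finally show ?thesis by (simp only: of_real_eq_iff)
qed

text \<open>Write \<open>(A p + C q)^2\<close> as \<open>(A p - C q)^2 + 4 A C p q\<close>. After
  inserting \<open>p q\<close> and \<open>B^2\<close>, the terms \<open>4 W A C \<rho>^2\<close>
  cancel; this bounds \<open>B\<close>, and then \<open>A p + C q\<close> by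
  \<open>p q\<close>.\<close>

lemma crossing_bound:
  fixes A C p q \<rho> B W :: real
  assumes A: "A \<ge> 0" and C: "C \<ge> 0" and p: "p > 0" and q: "q > 0"
    and \<rho>: "\<rho> \<ge> 0" and W: "W \<ge> 1"
    and pq: "p * q = 1 + \<rho>\<^sup>2" and B: "B\<^sup>2 = 1 + 4 * W * A * C"
    and le: "W * (A * p + C * q)\<^sup>2 \<le> (B * \<rho>)\<^sup>2"
  shows "A \<le> q" "C \<le> p" "B \<le> 1 + \<rho>"
proof -
  have "(A * p + C * q)\<^sup>2 = (A * p - C * q)\<^sup>2 + 4 * (A * C) * (p * q)"
    by (simp add: power2_eq_square algebra_simps)
  hence "W * (A * p - C * q)\<^sup>2 + 4 * W * (A * C) * (1 + \<rho>\<^sup>2) \<le> (1 + 4 * W * A * C) * \<rho>\<^sup>2"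
    using le unfolding power_mult_distrib B pq by (simp add: algebra_simps)
  hence "W * (A * p - C * q)\<^sup>2 + 4 * W * A * C \<le> \<rho>\<^sup>2"
    by (simp add: algebra_simps)
  moreover have "0 \<le> W * (A * p - C * q)\<^sup>2" using W by simp
  ultimately have "B\<^sup>2 \<le> 1 + \<rho>\<^sup>2" using B by linarith
  also have "\<dots> \<le> (1 + \<rho>)\<^sup>2" using \<rho> by (simp add: power2_eq_square algebra_simps)
  finally show "B \<le> 1 + \<rho>" by (rule power2_le_imp_le) (use \<rho> in simp)
  have "(A * p + C * q)\<^sup>2 \<le> W * (A * p + C * q)\<^sup>2"
    using W by (simp add: mult_le_cancel_right1)
  also have "\<dots> \<le> B\<^sup>2 * \<rho>\<^sup>2" using le unfolding power_mult_distrib .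
  also have "\<dots> \<le> (1 + \<rho>\<^sup>2) * \<rho>\<^sup>2"
    using \<open>B\<^sup>2 \<le> 1 + \<rho>\<^sup>2\<close> by (intro mult_right_mono) auto
  also have "\<dots> \<le> (1 + \<rho>\<^sup>2)\<^sup>2" by (simp add: power2_eq_square algebra_simps)
  finally have "A * p + C * q \<le> p * q" unfolding pq by (rule power2_le_imp_le) simp
  moreover have "0 \<le> A * p" "0 \<le> C * q" using A C p q by simp_all
  ultimately have "A * p \<le> q * p" "C * q \<le> p * q" by (simp_all add: mult.commute)
  thus "A \<le> q" "C \<le> p" using p q by simp_all
qed

context imaginary_order
begin

text \<open>A crossed plane satisfies the hypotheses of \<open>crossing_bound\<close>, which
  confines its three coefficients to a finite set.\<close>

lemma finite_crossing_down:
  assumes "g \<in> SL"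
  shows "finite {N \<in> forms. 0 < height N \<and> height (form_act N g) \<le> 0}"
proof -
  obtain a b c e where g: "g = mat2 a b c e" "a * e - b * c = 1"
    using assms by (rule SL_cases)
  define p where "p = (cmod a)\<^sup>2 + (cmod b)\<^sup>2"
  define q where "q = (cmod c)\<^sup>2 + (cmod e)\<^sup>2"
  define r where "r = cnj a * c + cnj b * e"
  have pq: "p * q = 1 + (cmod r)\<^sup>2"
    unfolding p_def q_def r_def by (rule column_gram[OF g(2)])
  have "p * q > 0" unfolding pq by (simp add: add_pos_nonneg)
  moreover have "p \<ge> 0" "q \<ge> 0" by (simp_all add: p_def q_def)
  ultimately have pos: "p > 0" "q > 0" by (auto simp: zero_less_mult_iff)
  let ?D = "{0..\<lceil>q\<rceil>} \<times> {0..\<lceil>p\<rceil>} \<times> {\<beta> \<in> Od. cmod \<beta> \<le> 1 + cmod r}"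
  let ?f = "\<lambda>(A, C, \<beta>). mat2 (of_int A * s) \<beta> (- cnj \<beta>) (of_int C * s)"
  have "{N \<in> forms. 0 < height N \<and> height (form_act N g) \<le> 0} \<subseteq> ?f ` ?D"
  proof
    fix N assume "N \<in> {N \<in> forms. 0 < height N \<and> height (form_act N g) \<le> 0}"
    hence N: "N \<in> forms" "0 < height N" "height (form_act N g) \<le> 0" by auto
    obtain A C y where y: "y \<in> Od" and shape: "N = mat2 (of_int A * s) (1 + s * y) (- cnj (1 + s * y)) (of_int C * s)"
      and det: "(cmod (1 + s * y))\<^sup>2 = 1 + 4 * (Im w)\<^sup>2 * of_int A * of_int C"
      using N(1) by (rule forms_shape)
    define \<beta> where "\<beta> = 1 + s * y"
    have \<beta>: "\<beta> \<in> Od" using y by (simp add: \<beta>_def)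
    have "real_of_int (A + C) > 0" using N(2) unfolding shape height_shape by simp
    hence AC: "A + C > 0" by linarith
    have "A * C \<ge> 0" by (rule forms_AC_nonneg[OF det])
    \<comment> \<open>Positive height means \<open>A + C > 0\<close>, and \<open>A\<close>,
      \<open>C\<close> never have opposite signs.\<close>
    hence A0: "A \<ge> 0" "C \<ge> 0" using AC by (auto simp: zero_le_mult_iff)
    have "of_int A * p + of_int C * q + Im (\<beta> * r) / Im w \<le> 0"
      using N(3) unfolding shape g height_form_act p_def q_def r_def \<beta>_def by simp
    hence "of_int A * p + of_int C * q \<le> \<bar>Im (\<beta> * r) / Im w\<bar>" by linarith
    also have "\<dots> \<le> cmod \<beta> * cmod r / \<bar>Im w\<bar>"
      unfolding abs_divide norm_mult[symmetric] by (intro divide_right_mono abs_Im_le_cmod) simp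
    finally have "\<bar>Im w\<bar> * (of_int A * p + of_int C * q) \<le> cmod \<beta> * cmod r"
      by (simp add: field_simps)
    hence "(\<bar>Im w\<bar> * (of_int A * p + of_int C * q))\<^sup>2 \<le> (cmod \<beta> * cmod r)\<^sup>2"
      using A0 pos by (intro power_mono) auto
    hence le: "(Im w)\<^sup>2 * (of_int A * p + of_int C * q)\<^sup>2 \<le> (cmod \<beta> * cmod r)\<^sup>2"
      by (simp only: power_mult_distrib power2_abs)
    have W: "1 \<le> (Im w)\<^sup>2" using Im_w by simp
    have "of_int A \<le> q" "of_int C \<le> p" "cmod \<beta> \<le> 1 + cmod r"
      using crossing_bound[OF _ _ pos _ W pq det[folded \<beta>_def] le] A0 by auto
    hence "(A, C, \<beta>) \<in> ?D" using A0 \<beta> by (auto simp: le_ceiling_iff)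
    thus "N \<in> ?f ` ?D" unfolding shape \<beta>_def[symmetric] by force
  qed
  moreover have "finite ?D" by (intro finite_SigmaI finite_O_bounded) auto
  ultimately show ?thesis by (meson finite_imageI finite_subset)
qed

section \<open>Crossing numbers and their additivity\<close>

definition side :: "complex^2^2 \<Rightarrow> int" where
  "side N = of_bool (0 < height N)"

definition crossing_set :: "complex^2^2 \<Rightarrow> (complex^2^2) set" where
  "crossing_set g = {N \<in> forms. side (form_act N g) \<noteq> side N}"

definition crossing :: "complex^2^2 \<Rightarrow> int" where
  "crossing g = (\<Sum>N\<in>crossing_set g. side (form_act N g) - side N)"

lemma finite_crossing_set: assumes g: "g \<in> SL" shows "finite (crossing_set g)"
proof -
  obtain h where h: "h \<in> SL" "g ** h = mat 1" using SL_inverse[OF g] by blast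
  let ?D = "\<lambda>g. {N \<in> forms. 0 < height N \<and> height (form_act N g) \<le> 0}"
  let ?U = "{N \<in> forms. height N \<le> 0 \<and> 0 < height (form_act N g)}"
  \<comment> \<open>A plane crossed upwards by \<open>g\<close> is carried by \<open>g\<close> to
    one crossed downwards by the inverse of \<open>g\<close>.\<close>
  have "(\<lambda>N. form_act N g) ` ?U \<subseteq> ?D h"
    by (auto simp: form_act_mult[symmetric] h g intro: form_act_in_forms)
  moreover have "inj_on (\<lambda>N. form_act N g) ?U"
    by (rule inj_on_subset[OF bij_betw_imp_inj_on[OF bij_form_act[OF g]]]) auto
  ultimately have "finite ?U" using finite_crossing_down[OF h(1)] by (meson inj_on_finite)
  moreover have "crossing_set g \<subseteq> ?D g \<union> ?U"
    by (auto simp: crossing_set_def side_def)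
  ultimately show ?thesis using finite_crossing_down[OF g] by (meson finite_UnI finite_subset)
qed

text \<open>Lets the crossing numbers of several matrices be summed over one index set.\<close>

lemma crossing_eq_sum:
  assumes "crossing_set g \<subseteq> X" "X \<subseteq> forms" "finite X"
  shows "crossing g = (\<Sum>N\<in>X. side (form_act N g) - side N)"
  unfolding crossing_def by (rule sum.mono_neutral_left) (use assms in \<open>auto simp: crossing_set_def\<close>)

text \<open>The side changes from \<open>N\<close> to \<open>N g\<close> and from \<open>N g\<close>
  to \<open>N g h\<close> telescope, once the sum for \<open>h\<close> is reindexed along the
  bijection of the orbit given by \<open>g\<close>.\<close>

lemma crossing_mult:
  assumes g: "g \<in> SL" and h: "h \<in> SL"
  shows "crossing (g ** h) = crossing g + crossing h"
proof -
  let ?a = "\<lambda>N. form_act N g"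
  define Y where "Y = {N \<in> forms. ?a N \<in> crossing_set h}"
  define X where "X = crossing_set g \<union> Y \<union> crossing_set (g ** h)"
  have bij: "bij_betw ?a Y (crossing_set h)"
  proof (rule bij_betw_subset[OF bij_form_act[OF g]])
    show "Y \<subseteq> forms" by (auto simp: Y_def)
    show "?a ` Y = crossing_set h"
      using bij_betw_imp_surj_on[OF bij_form_act[OF g]] by (auto simp: Y_def crossing_set_def)
  qed
  have fX: "finite X" "X \<subseteq> forms"
    using finite_crossing_set[OF g] finite_crossing_set[OF h] finite_crossing_set[OF SL_mult[OF g h]]
      bij_betw_finite[OF bij]
    by (auto simp: X_def Y_def crossing_set_def)
  have "crossing h = (\<Sum>N\<in>Y. side (form_act (?a N) h) - side (?a N))"
    unfolding crossing_def by (rule sum.reindex_bij_betw[OF bij, symmetric])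
  also have "\<dots> = (\<Sum>N\<in>X. side (form_act (?a N) h) - side (?a N))"
    by (rule sum.mono_neutral_left)
      (use fX form_act_in_forms[OF _ g] in \<open>auto simp: X_def Y_def crossing_set_def\<close>)
  finally have h': "crossing h = (\<Sum>N\<in>X. side (form_act N (g ** h)) - side (?a N))"
    by (simp add: form_act_mult)
  have "crossing g = (\<Sum>N\<in>X. side (?a N) - side N)"
    by (rule crossing_eq_sum) (use fX in \<open>auto simp: X_def\<close>)
  moreover have "crossing (g ** h) = (\<Sum>N\<in>X. side (form_act N (g ** h)) - side N)"
    by (rule crossing_eq_sum) (use fX in \<open>auto simp: X_def\<close>)
  ultimately show ?thesis unfolding h' by (simp add: sum.distrib[symmetric])
qed

lemma crossing_minus [simp]: "crossing (- g) = crossing g"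
  by (simp add: crossing_def crossing_set_def)

lemma crossing_one [simp]: "crossing (mat 1) = 0"
  by (simp add: crossing_def)

text \<open>Forms with \<open>A \<noteq> 0\<close> are hemispheres of radius less than one, below all points of height one.\<close>

lemma height_translate_pos_iff:
  assumes A: "A \<noteq> 0" and det: "(cmod \<beta>)\<^sup>2 = 1 + 4 * (Im w)\<^sup>2 * of_int A * of_int C"
  shows "0 < height (form_act (mat2 (of_int A * s) \<beta> (- cnj \<beta>) (of_int C * s)) (mat2 1 z 0 1)) \<longleftrightarrow> 0 < A"
proof -
  define H where "H = height (form_act (mat2 (of_int A * s) \<beta> (- cnj \<beta>) (of_int C * s)) (mat2 1 z 0 1))"
  define a c v where "a = real_of_int A" and "c = real_of_int C" and "v = Im w"
  have v: "v \<noteq> 0" "v\<^sup>2 > 1" using Im_w by (auto simp: v_def)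
  have H: "H = a * (1 + (cmod z)\<^sup>2) + c + Im (\<beta> * cnj z) / v"
    unfolding H_def height_form_act by (simp add: a_def c_def v_def)
  have ac: "4 * v\<^sup>2 * a * c = (Re \<beta>)\<^sup>2 + (Im \<beta>)\<^sup>2 - 1"
    using det unfolding cmod_power2 by (simp add: a_def c_def v_def)
  \<comment> \<open>Completing squares after eliminating \<open>c\<close>: the remainder
    \<open>4 v^2 a^2 - 1\<close> is positive since \<open>a\<close> is a nonzero integer and
    \<open>v^2 > 1\<close>, so \<open>H\<close> has the sign of \<open>a\<close>.\<close>
  have "4 * v\<^sup>2 * (a * H) = (2 * v * a * Re z + Im \<beta>)\<^sup>2 + (2 * v * a * Im z - Re \<beta>)\<^sup>2 + (4 * v\<^sup>2 * a\<^sup>2 - 1)"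
  proof -
    have "4 * v\<^sup>2 * (a * H) = 4 * v\<^sup>2 * a\<^sup>2 * (1 + (cmod z)\<^sup>2) + 4 * v\<^sup>2 * a * c + 4 * v * a * Im (\<beta> * cnj z)"
      unfolding H using v by (simp add: field_simps power2_eq_square)
    thus ?thesis unfolding ac cmod_power2 by (simp add: power2_eq_square algebra_simps)
  qed
  moreover have "4 * v\<^sup>2 * a\<^sup>2 > 1"
  proof -
    have "1 \<le> \<bar>A\<bar>" using A by linarith
    hence "1 \<le> \<bar>a\<bar>" unfolding a_def by linarith
    hence "1 \<le> a\<^sup>2" using abs_le_square_iff[of 1 a] by simp
    hence "1 * 1 \<le> v\<^sup>2 * a\<^sup>2" using v by (intro mult_mono) auto
    thus ?thesis by simp
  qed
  ultimately have "4 * v\<^sup>2 * (a * H) > 0" by (simp add: add_nonneg_pos)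
  hence "a * H > 0" using v by (simp add: zero_less_mult_iff)
  thus ?thesis unfolding H_def[symmetric] by (auto simp: zero_less_mult_iff a_def)
qed

text \<open>For \<open>y = m + n w\<close> the equation says \<open>(cmod y)^2 = n\<close>, but a
  nonzero \<open>n\<close> would give \<open>(cmod y)^2 > n^2 \<ge> n\<close>. In particular
  \<open>1 + s * y = -1\<close> is impossible, so no vertical plane occurs with reversed
  orientation.\<close>

lemma unit_congruent_one:
  assumes y: "y \<in> Od" and norm: "(cmod (1 + s * y))\<^sup>2 = 1"
  shows "y = 0"
proof -
  obtain m n where mn: "y = of_int m + of_int n * w" using y by (auto simp: integers_of_iff)
  define v where "v = Im w"
  have v: "v\<^sup>2 > 1" using Im_w by (simp add: v_def)
  have Imy: "Im y = of_int n * v" by (simp add: mn v_def)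
  have "(1 - 2 * v * Im y)\<^sup>2 + (2 * v * Re y)\<^sup>2 = 1"
    using norm unfolding cmod_power2 by (simp add: s_eq v_def)
  hence "4 * v * (v * (Re y)\<^sup>2 + v * (Im y)\<^sup>2 - Im y) = 0"
    by (simp add: power2_eq_square algebra_simps)
  moreover have "4 * v \<noteq> 0" using v by auto
  ultimately have "v * (Re y)\<^sup>2 + v * (Im y)\<^sup>2 - Im y = 0" by (simp only: mult_eq_0_iff) simp
  hence "v * ((Re y)\<^sup>2 + (Im y)\<^sup>2) = Im y" by (simp add: algebra_simps)
  hence "v * ((Re y)\<^sup>2 + (Im y)\<^sup>2) = v * of_int n" unfolding Imy by simp
  hence eq: "(Re y)\<^sup>2 + (of_int n)\<^sup>2 * v\<^sup>2 = of_int n" using v unfolding Imy by (auto simp: power_mult_distrib)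
  have n0: "n = 0"
  proof (rule ccontr)
    assume "n \<noteq> 0"
    hence n2: "(real_of_int n)\<^sup>2 > 0" by simp
    hence "(real_of_int n)\<^sup>2 * v\<^sup>2 > (real_of_int n)\<^sup>2 * 1" using v by (intro mult_strict_left_mono) auto
    hence "(real_of_int n)\<^sup>2 < of_int n" using eq zero_le_power2[of "Re y"] by linarith
    hence "n\<^sup>2 < n" by (metis of_int_less_iff of_int_power)
    moreover have "n \<le> n\<^sup>2" by (cases "n \<le> 0") (auto simp: power2_eq_square intro: order_trans[of _ 0])
    ultimately show False by simp
  qed
  with eq have "Re y = 0" by simp
  moreover have "Im y = 0" using n0 Imy by simp
  ultimately show ?thesis by (simp add: complex_eq_iff)
qed

text \<open>Translations cross only vertical planes, those with \<open>A = 0\<close>. There is one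
  of them for each integer \<open>C\<close>, and the translation shifts \<open>C\<close> by
  \<open>- n\<close>; what is counted is the passage through 0.\<close>

lemma crossing_translation:
  "crossing (mat2 1 (of_int m + of_int n * w) 0 1) = - n"
proof -
  define z where "z = of_int m + of_int n * w"
  let ?g = "mat2 1 z 0 1"
  let ?N = "\<lambda>C::int. mat2 0 1 (-1) (of_int C * s)"
  have N_forms: "?N C \<in> forms" for C
  proof -
    have "?N C = form_act (mat2 0 1 (-1) 0) (mat2 1 (of_int (- C) * w) 0 1)"
      unfolding form_act_base by (simp add: s_def algebra_simps)
    thus ?thesis unfolding forms_def by (auto intro!: image_eqI)
  qed
  have "z - cnj z = of_int n * s" by (simp add: z_def s_def algebra_simps)
  hence actN: "form_act (?N C) ?g = ?N (C - n)" for C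
    by (simp add: form_act_def algebra_simps)
  have side0: "side (?N C) = of_bool (0 < C)" for C
    using height_shape[of 0 1 "-1" C] by (simp add: side_def)
  have "N \<in> range ?N" if N: "N \<in> crossing_set ?g" for N
  proof -
    obtain A C y where y: "y \<in> Od" and shape: "N = mat2 (of_int A * s) (1 + s * y) (- cnj (1 + s * y)) (of_int C * s)"
      and det: "(cmod (1 + s * y))\<^sup>2 = 1 + 4 * (Im w)\<^sup>2 * of_int A * of_int C"
      using N unfolding crossing_set_def by (auto elim: forms_shape)
    have "A = 0"
    proof (rule ccontr)
      assume A: "A \<noteq> 0"
      have "form_act N (mat2 1 0 0 1) = N" by (simp flip: mat_1_eq_mat2)
      hence "0 < height N \<longleftrightarrow> 0 < A" using height_translate_pos_iff[OF A det, of 0] shape by simp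
      moreover have "0 < height (form_act N ?g) \<longleftrightarrow> 0 < A"
        using height_translate_pos_iff[OF A det, of z] shape by simp
      ultimately show False using N by (simp add: crossing_set_def side_def)
    qed
    moreover from this det have "y = 0" by (intro unit_congruent_one[OF y]) simp
    ultimately show ?thesis using shape by auto
  qed
  moreover have "?N C \<in> crossing_set ?g \<longleftrightarrow> (0 < C - n) \<noteq> (0 < C)" for C
    unfolding crossing_set_def mem_Collect_eq actN side0 using N_forms[of C] by auto
  ultimately have cs: "crossing_set ?g = ?N ` {C. (0 < C - n) \<noteq> (0 < C)}"
    by blast
  have "inj_on ?N X" for X by (auto simp: inj_on_def)
  hence cr: "crossing ?g = (\<Sum>C | (0 < C - n) \<noteq> (0 < C). of_bool (0 < C - n) - of_bool (0 < C))"
    unfolding crossing_def cs by (subst sum.reindex) (simp_all only: o_def actN side0)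
  show ?thesis
  \<comment> \<open>The plane with \<open>C = 0\<close> contains the base point and has side 0.
    Hence the crossed planes are \<open>1..n\<close>, each counted -1, or \<open>n + 1..0\<close>,
    each counted 1.\<close>
  proof (cases "n \<ge> 0")
    case True
    hence "{C. (0 < C - n) \<noteq> (0 < C)} = {1..n}" by auto
    moreover have "(\<Sum>C\<in>{1..n}. of_bool (0 < C - n) - of_bool (0 < C)) = (\<Sum>C\<in>{1..n}. - 1 :: int)"
      by (rule sum.cong) auto
    ultimately show ?thesis unfolding cr[unfolded z_def] using True by simp
  next
    case False
    hence "{C. (0 < C - n) \<noteq> (0 < C)} = {n + 1..0}" by auto
    moreover have "(\<Sum>C\<in>{n + 1..0}. of_bool (0 < C - n) - of_bool (0 < C)) = (\<Sum>C\<in>{n + 1..0}. 1 :: int)"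
      by (rule sum.cong) auto
    ultimately show ?thesis unfolding cr[unfolded z_def] using False by simp
  qed
qed

end

section \<open>Elements congruent to the identity\<close>

context imaginary_order
begin

lemma SL2_simps [simp]:
  "carrier (SL2 d) = SL" "mult (SL2 d) = (**)" "one (SL2 d) = mat 1"
  by (simp_all add: SL2_def SL_def)

lemma group_SL2: "group (SL2 d)"
  by (rule groupI) (use SL_inverse in \<open>auto simp: SL_mult SL_one matrix_mul_assoc\<close>)

lemma inv_SL2:
  assumes "mat2 a b c e \<in> SL"
  shows "inv\<^bsub>SL2 d\<^esub> (mat2 a b c e) = mat2 e (- b) (- c) a"
  by (rule group.inv_equality[OF group_SL2])
    (use assms in \<open>auto simp: mat_1_eq_mat2 algebra_simps\<close>)

text \<open>The norms differ by \<open>m\<close> times \<open>r\<close>, a real element of the order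
  and hence an integer.\<close>

lemma norm_cong:
  assumes "y \<in> Od" "z \<in> Od" and x: "x = y + of_int m * z"
    and a: "x * cnj x = of_int a" and b: "y * cnj y = of_int b"
  shows "m dvd a - b"
proof -
  define r where "r = y * cnj z + z * cnj y + of_int m * (z * cnj z)"
  have "r \<in> Od" "Im r = 0" using assms(1,2) by (simp_all add: r_def)
  then obtain k where k: "r = of_int k" using O_real by blast
  have "x * cnj x = y * cnj y + of_int m * r" by (simp add: x r_def algebra_simps)
  hence "of_int a = (of_int (b + m * k) :: complex)" unfolding a b k by simp
  hence "a = b + m * k" by (simp only: of_int_eq_iff)
  thus ?thesis by simp
qed

end

text \<open>\<open>C\<close> is later the whole of \<open>SL(2, O_d)\<close> or its elementary
  subgroup, so one argument covers both groups.\<close>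

locale elementary_overgroup = imaginary_order +
  fixes C :: "(complex^2^2) set"
  assumes subgroup_C: "subgroup C (SL2 d)"
    and gens_C: "mat2 1 1 0 1 \<in> C" "mat2 1 w 0 1 \<in> C" "mat2 0 1 (-1) 0 \<in> C"
begin

section \<open>Elementary matrices in the overgroup\<close>

lemma C_subset: "C \<subseteq> SL"
  using subgroup.subset[OF subgroup_C] by simp

lemma C_mult: "A \<in> C \<Longrightarrow> B \<in> C \<Longrightarrow> A ** B \<in> C"
  using subgroup.m_closed[OF subgroup_C] by simp

lemma C_one: "mat 1 \<in> C"
  using subgroup.one_closed[OF subgroup_C] by simp

lemma C_inverse: assumes "mat2 a b c e \<in> C" shows "mat2 e (- b) (- c) a \<in> C"
  using subgroup.m_inv_closed[OF subgroup_C assms] inv_SL2[of a b c e] C_subset assms by auto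

lemma crossing_mult_C: "A \<in> C \<Longrightarrow> B \<in> C \<Longrightarrow> crossing (A ** B) = crossing A + crossing B"
  using C_subset by (intro crossing_mult) auto

lemma C_minus: assumes "A \<in> C" shows "- A \<in> C"
proof -
  \<comment> \<open>The third generator squares to minus the identity.\<close>
  have "mat2 0 1 (-1) 0 ** mat2 0 1 (-1) 0 ** A \<in> C"
    using assms gens_C C_mult by blast
  thus ?thesis by (cases A rule: mat2_cases) simp
qed

lemma C_translation_multiple:
  assumes "mat2 1 z 0 1 \<in> C" shows "mat2 1 (of_int n * z) 0 1 \<in> C"
proof -
  have nat: "mat2 1 (of_nat k * z) 0 1 \<in> C" for k
  proof (induction k)
    case 0
    show ?case using C_one by (simp add: mat_1_eq_mat2)
  next
    case (Suc k)
    show ?case using C_mult[OF Suc assms] by (simp add: algebra_simps)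
  qed
  show ?thesis
  proof (cases "n \<ge> 0")
    case True
    thus ?thesis using nat[of "nat n"] by simp
  next
    case False
    thus ?thesis using C_inverse[OF nat[of "nat (- n)"]] by simp
  qed
qed

lemma C_translation: assumes "x \<in> Od" shows "mat2 1 x 0 1 \<in> C"
proof -
  obtain m n where x: "x = of_int m + of_int n * w" using assms by (auto simp: integers_of_iff)
  show ?thesis
    using C_mult[OF C_translation_multiple[OF gens_C(1), of m] C_translation_multiple[OF gens_C(2), of n]]
    by (simp add: x add.commute)
qed

lemma C_lower: assumes "x \<in> Od" shows "mat2 1 0 x 1 \<in> C"
proof -
  have "mat2 0 (-1) 1 0 \<in> C" using C_inverse[OF gens_C(3)] by simp
  moreover have "mat2 1 (- x) 0 1 \<in> C" using assms by (intro C_translation) simp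
  ultimately have "mat2 0 (-1) 1 0 ** mat2 1 (- x) 0 1 ** mat2 0 1 (-1) 0 \<in> C"
    using gens_C C_mult by blast
  thus ?thesis by simp
qed

text \<open>The Whitehead product, congruent modulo \<open>k\<close> to the diagonal matrix with entries \<open>l\<close> and \<open>m\<close>.\<close>

lemma C_whitehead:
  assumes "l \<in> Od" "m \<in> Od" and lm: "l * m = 1 + k"
  shows "mat2 (l * (1 - k)) k (- k) m \<in> C"
proof -
  have "mat2 0 (-1) 1 0 \<in> C" using C_inverse[OF gens_C(3)] by simp
  moreover have "mat2 1 l 0 1 \<in> C" "mat2 1 0 (- m) 1 \<in> C"
    using assms by (auto intro: C_translation C_lower)
  ultimately have "mat2 1 l 0 1 ** mat2 1 0 (- m) 1 ** mat2 1 l 0 1 ** mat2 0 (-1) 1 0 \<in> C"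
    using C_mult by blast
  also have "mat2 1 l 0 1 ** mat2 1 0 (- m) 1 ** mat2 1 l 0 1 ** mat2 0 (-1) 1 0 =
      mat2 (l + l - l * (l * m)) (l * m - 1) (1 - l * m) m"
    by (simp add: algebra_simps)
  also have "\<dots> = mat2 (l * (1 - k)) k (- k) m"
    unfolding lm by (simp add: algebra_simps)
  finally show ?thesis .
qed

text \<open>Conjugating a translation by the Whitehead product multiplies it by \<open>l\<^sup>2\<close> modulo \<open>N\<close>.\<close>

lemma crossing_congruent_one:
  assumes lO: "l \<in> Od" and mO: "m \<in> Od" and lm: "l * m = 1 + of_int (N * k)"
    and x: "x \<in> Od" and xl: "(l\<^sup>2 - 1) * x = of_int b * w"
  shows "\<exists>A\<in>C. (\<forall>i j. \<exists>z\<in>Od. A $ i $ j - mat 1 $ i $ j = z * of_int N) \<and> crossing A = b"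
proof -
  define K :: complex where "K = of_int (N * k)"
  define a where "a = l * (1 - K)"
  have K: "K \<in> Od" and aO: "a \<in> Od" using lO by (simp_all only: K_def a_def of_int_in_O O_diff O_mult O_basic)
  let ?h = "mat2 a K (- K) m" and ?h' = "mat2 m (- K) K a"
  let ?X = "mat2 1 x 0 1" and ?Y = "mat2 1 (- (l\<^sup>2 * x)) 0 1"
  have h: "?h \<in> C"
    unfolding a_def using lm by (intro C_whitehead lO mO) (simp add: K_def)
  have h': "?h' \<in> C" using C_inverse[OF h] by simp
  have "l\<^sup>2 * x \<in> Od" using lO x by (simp add: power2_eq_square)
  hence XY: "?X \<in> C" "?Y \<in> C" using x by (auto intro!: C_translation)
  \<comment> \<open>Modulo \<open>N\<close> the product \<open>?h ** ?X ** ?h'\<close> is the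
    translation by \<open>l^2 x\<close>, and \<open>?Y\<close> undoes it.\<close>
  define A where "A = ?h ** ?X ** ?h' ** ?Y"
  have AC: "A \<in> C" unfolding A_def using h h' XY C_mult by blast
  have det: "a * m + K * K = 1"
  proof -
    have "a * m = (1 + K) * (1 - K)" using lm unfolding a_def K_def by (simp add: mult.commute mult.left_commute)
    thus ?thesis by (simp add: algebra_simps)
  qed
  have hh': "?h ** ?h' = mat 1" using det by (simp add: mat_1_eq_mat2 algebra_simps)
  \<comment> \<open>\<open>crossing\<close> has abelian values, so \<open>?h\<close> and its inverse
    cancel; what remains is the translation by \<open>(1 - l^2) x = - b w\<close>.\<close>
  have "crossing A = crossing ?h + crossing ?X + crossing ?h' + crossing ?Y"
    unfolding A_def by (simp only: crossing_mult_C C_mult h h' XY)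
  also have "\<dots> = crossing (?h ** ?h') + crossing (?X ** ?Y)"
    by (simp only: crossing_mult_C h h' XY)
  also have "\<dots> = crossing (?X ** ?Y)" unfolding hh' by simp
  also have "?X ** ?Y = mat2 1 (of_int 0 + of_int (- b) * w) 0 1"
    using xl by (simp add: algebra_simps)
  also have "crossing \<dots> = b" unfolding crossing_translation by simp
  finally have cr: "crossing A = b" .
  have A: "A = mat2 (1 + a * K * x) (a\<^sup>2 * x - (1 + a * K * x) * (l\<^sup>2 * x)) (- K * K * x) (1 - a * K * x + K * K * x * (l\<^sup>2 * x))"
  proof -
    have "?h ** ?X ** ?h' = mat2 (a * m + K * K + a * K * x) (a\<^sup>2 * x) (- K * K * x) (a * m + K * K - a * K * x)"
      by (simp add: algebra_simps power2_eq_square)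
    hence XX: "?h ** ?X ** ?h' = mat2 (1 + a * K * x) (a\<^sup>2 * x) (- K * K * x) (1 - a * K * x)"
      unfolding det .
    show ?thesis unfolding A_def XX by (simp add: algebra_simps)
  qed
  \<comment> \<open>The factor \<open>N\<close> of each entry of \<open>A - mat 1\<close> comes from
    \<open>K\<close>; in the upper right corner through
    \<open>a^2 - l^2 = l^2 K (K - 2)\<close>.\<close>
  have KN: "K = of_int k * of_int N" by (simp add: K_def)
  have "A $ 1 $ 1 - 1 = (a * of_int k * x) * of_int N" unfolding A by (simp add: KN)
  moreover have "A $ 1 $ 2 = (l\<^sup>2 * (of_int k * (K - 2)) * x - a * of_int k * x * (l\<^sup>2 * x)) * of_int N"
    unfolding A a_def by (simp add: KN power2_eq_square algebra_simps)
  moreover have "A $ 2 $ 1 = (- of_int k * K * x) * of_int N" unfolding A by (simp add: KN)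
  moreover have "A $ 2 $ 2 - 1 = (- a * of_int k * x + of_int k * K * x * (l\<^sup>2 * x)) * of_int N"
    unfolding A by (simp add: KN algebra_simps)
  moreover have "a * of_int k * x \<in> Od" "l\<^sup>2 * (of_int k * (K - 2)) * x - a * of_int k * x * (l\<^sup>2 * x) \<in> Od"
    "- of_int k * K * x \<in> Od" "- a * of_int k * x + of_int k * K * x * (l\<^sup>2 * x) \<in> Od"
    using aO K x lO unfolding power2_eq_square by (auto intro!: O_mult O_diff O_add)
  ultimately have "\<forall>i j. \<exists>z\<in>Od. A $ i $ j - mat 1 $ i $ j = z * of_int N"
    unfolding forall_2 mat_1_eq_mat2 mat2_nth diff_0_right by blast
  with AC cr show ?thesis by blast
qed

text \<open>By the Chinese remainder theorem, take \<open>l\<close> congruent to \<open>r\<close>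
  modulo \<open>q\<close> and to 1 modulo the part of \<open>N\<close> prime to \<open>q\<close>.
  Then the norm of \<open>l\<close> is prime to \<open>N\<close>, so \<open>l\<close> is invertible
  modulo \<open>N\<close>, while the norm of \<open>l^2 - 1\<close> stays prime to
  \<open>q\<close>.\<close>

lemma congruent_one_crossing_not_dvd:
  fixes N q :: int
  assumes N: "N > 0" and q: "prime q" and r: "r \<in> Od"
    and a: "r * cnj r = of_int a" and b: "(r\<^sup>2 - 1) * cnj (r\<^sup>2 - 1) = of_int b"
    and ndvd: "\<not> q dvd a" "\<not> q dvd b"
  shows "\<exists>A\<in>C. (\<forall>i j. \<exists>z\<in>Od. A $ i $ j - mat 1 $ i $ j = z * of_int N) \<and> \<not> q dvd crossing A"
proof -
  define n where "n = multiplicity q N"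
  obtain M where M: "N = q ^ n * M" and "\<not> q dvd M"
    using multiplicity_decompose'[of N q] N q unfolding n_def
    by (metis not_prime_unit not_less_iff_gr_or_eq)
  hence "coprime q M" using q by (simp add: prime_imp_coprime)
  then obtain u v where uv: "u * q + v * M = 1" using bezout_int[of q M] by auto
  define l where "l = 1 + of_int (v * M) * (r - 1)"
  have l1: "l = 1 + of_int M * (of_int v * (r - 1))" by (simp add: l_def algebra_simps)
  have vM: "v * M = 1 - u * q" using uv by simp
  have l2: "l = r + of_int q * (of_int (- u) * (r - 1))"
    unfolding l_def vM by (simp add: algebra_simps)
  have lO: "l \<in> Od" unfolding l_def using r by (intro O_add O_mult O_diff) auto
  obtain a' where a': "l * cnj l = of_int a'" using O_norm[OF lO] by blast
  have "q dvd a' - a" by (rule norm_cong[OF r _ l2 a' a]) (use r in \<open>intro O_mult O_diff, auto\<close>)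
  hence "\<not> q dvd a'" using ndvd(1) by (metis dvd_diff_right_iff)
  hence "coprime (q ^ n) a'" using q by (simp add: prime_imp_coprime)
  moreover have "M dvd a' - 1" by (rule norm_cong[OF _ _ l1 a']) (use r in \<open>auto intro!: O_mult O_diff\<close>)
  hence "coprime M a'" by (intro coprimeI) (metis dvd_trans dvd_diff_right_iff)
  ultimately have "coprime N a'" unfolding M by simp
  then obtain k' c where kc: "k' * N + c * a' = 1" using bezout_int[of N a'] by auto
  \<comment> \<open>An inverse of \<open>l\<close> modulo \<open>N\<close>: the conjugate of
    \<open>l\<close> times an inverse of its norm.\<close>
  define m where "m = of_int c * cnj l"
  have mO: "m \<in> Od" using lO by (simp add: m_def)
  have "l * m = of_int (c * a')" using a' by (simp add: m_def)
  also have "c * a' = 1 + N * (- k')" using kc by (simp add: algebra_simps)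
  finally have lm: "l * m = 1 + of_int (N * (- k'))" by simp
  define y where "y = r\<^sup>2 - 1"
  define y' where "y' = l\<^sup>2 - 1"
  have y'O: "y' \<in> Od" using lO by (simp add: y'_def power2_eq_square)
  obtain b' where b': "y' * cnj y' = of_int b'" using O_norm[OF y'O] by blast
  define z where "z = of_int (- u) * (r - 1) * (2 * r + of_int q * (of_int (- u) * (r - 1)))"
  have yz: "y' = y + of_int q * z"
    unfolding y'_def y_def z_def l2 by (simp add: power2_eq_square algebra_simps)
  have "q dvd b' - b"
  proof (rule norm_cong[OF _ _ yz b'])
    show "y \<in> Od" using r by (simp add: y_def power2_eq_square)
    show "z \<in> Od" unfolding z_def using r by (intro O_mult O_add O_diff) auto
    show "y * cnj y = of_int b" using b by (simp add: y_def)
  qed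
  hence "\<not> q dvd b'" using ndvd(2) by (metis dvd_diff_right_iff)
  \<comment> \<open>With \<open>x = cnj y' * w\<close> the product \<open>(l^2 - 1) x\<close> is the
    norm \<open>b'\<close> times \<open>w\<close>, and \<open>b'\<close> becomes the crossing
    number.\<close>
  moreover have "cnj y' * w \<in> Od" using y'O by simp
  moreover have "(l\<^sup>2 - 1) * (cnj y' * w) = of_int b' * w"
    using b' unfolding y'_def[symmetric] by (simp add: mult.assoc[symmetric])
  ultimately show ?thesis
    using crossing_congruent_one[OF lO mO lm, of "cnj y' * w" b'] by metis
qed

end

context imaginary_order
begin

text \<open>For \<open>q \<ge> 5\<close> take \<open>r = 2\<close>, with norms 4 and 9. For inert
  \<open>q\<close> take \<open>r = w\<close>: the elements \<open>w\<close>, \<open>w - 1\<close>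
  and \<open>w + 1\<close> have coefficient 1 at \<open>w\<close>, so they lie outside the prime
  ideal \<open>(q)\<close>.\<close>

lemma exists_unit_mod_prime:
  fixes q :: nat
  assumes q: "prime q" and "inert_in d q \<or> q \<ge> 5"
  shows "\<exists>r\<in>Od. \<exists>a b. r * cnj r = of_int a \<and> (r\<^sup>2 - 1) * cnj (r\<^sup>2 - 1) = of_int b \<and>
    \<not> int q dvd a \<and> \<not> int q dvd b"
  using assms(2)
proof
  assume q5: "q \<ge> 5"
  have "\<not> q dvd 2" "\<not> q dvd 3" using q5 by (auto dest: dvd_imp_le)
  hence "\<not> q dvd 2 * 2" "\<not> q dvd 3 * 3" using q prime_dvd_mult_iff by blast+
  hence "\<not> int q dvd int 4" "\<not> int q dvd int 9" unfolding int_dvd_int_iff by simp_all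
  thus ?thesis
    by (intro bexI[of _ 2] exI[of _ 4] exI[of _ 9]) auto
next
  assume "inert_in d q"
  then interpret P: primeideal "PIdl\<^bsub>O_ring d\<^esub> (of_nat q)" "O_ring d"
    by (simp add: inert_in_def)
  define P where "P = PIdl\<^bsub>O_ring d\<^esub> (of_nat q :: complex)"
  have P: "x \<in> P \<longleftrightarrow> (\<exists>z\<in>Od. x = z * of_nat q)" for x
    by (auto simp: P_def cgenideal_def O_ring_def)
  have prime: "x * y \<notin> P" if "x \<in> Od" "y \<in> Od" "x \<notin> P" "y \<notin> P" for x y
    using P.I_prime[of x y] that by (auto simp: P_def O_ring_def)
  \<comment> \<open>The generator \<open>q\<close> is rational, so the ideal is stable under
    conjugation; by primality, elements outside it have norms outside it.\<close>
  have cnj: "cnj x \<notin> P" if "x \<notin> P" for x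
  proof
    assume "cnj x \<in> P"
    then obtain z where "z \<in> Od" "cnj x = z * of_nat q" using P by blast
    hence "cnj z \<in> Od" "x = cnj z * of_nat q" by (auto simp: complex_eq_iff)
    thus False using that P by blast
  qed
  have wm: "of_int m + w \<notin> P" for m
  proof
    assume "of_int m + w \<in> P"
    then obtain z where "z \<in> Od" "of_int m + w = z * of_nat q" using P by blast
    then obtain m' n' where "of_int m + of_int 1 * w = of_int (m' * int q) + of_int (n' * int q) * w"
      by (auto simp: integers_of_iff algebra_simps)
    hence "1 = n' * int q" by (rule basis_unique)
    hence "int q dvd 1" by (metis dvd_triv_right)
    thus False using q by (simp add: not_prime_1)
  qed
  have norm: "\<exists>a. x * cnj x = of_int a \<and> \<not> int q dvd a" if x: "x \<in> Od" "x \<notin> P" for x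
  proof -
    obtain a where a: "x * cnj x = of_int a" using O_norm[OF x(1)] by blast
    have "x * cnj x \<notin> P" using x by (intro prime cnj) auto
    hence "\<not> int q dvd a" unfolding a P by (auto elim!: dvdE simp: mult.commute)
    with a show ?thesis by blast
  qed
  have w: "w \<in> Od" "w \<notin> P" using wm[of 0] by simp_all
  have "w\<^sup>2 - 1 = (of_int (-1) + w) * (of_int 1 + w)" by (simp add: power2_eq_square algebra_simps)
  moreover have "(of_int (-1) + w) * (of_int 1 + w) \<notin> P"
    by (intro prime wm O_add of_int_in_O w_in_O)
  ultimately have "w\<^sup>2 - 1 \<notin> P" by simp
  moreover have "w\<^sup>2 - 1 \<in> Od" by (simp add: power2_eq_square)
  ultimately show ?thesis using norm[OF w] norm[of "w\<^sup>2 - 1"] w(1) by blast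
qed

end

section \<open>The non-congruence subgroup\<close>

context elementary_overgroup
begin

section \<open>The quotient by plus or minus the identity\<close>

definition H :: "(complex^2^2) monoid" where "H = (SL2 d)\<lparr>carrier := C\<rparr>"

text \<open>For the two choices of \<open>C\<close> this is \<open>Bianchi d\<close> and
  \<open>PE2 d w\<close>.\<close>

definition PH :: "(complex^2^2) set monoid" where "PH = H Mod {mat 1, - mat 1}"

lemma H_simps [simp]: "carrier H = C" "mult H = (**)" "one H = mat 1"
  by (simp_all add: H_def)

lemma group_H: "group H"
  unfolding H_def by (rule subgroup.subgroup_is_group[OF subgroup_C group_SL2])

lemma rcoset_center: "{mat 1, - mat 1} #>\<^bsub>H\<^esub> A = pm A"
  by (auto simp: r_coset_def pm_def matrix_mul_minus_left)

lemma normal_center: "{mat 1, - mat 1} \<lhd> H"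
proof (rule group.normalI[OF group_H])
  have "inv\<^bsub>H\<^esub> (- mat 1) = - mat 1"
    by (rule group.inv_equality[OF group_H])
      (auto simp: matrix_mul_minus_left matrix_mul_minus_right C_one C_minus)
  moreover have "inv\<^bsub>H\<^esub> (mat 1) = mat 1"
    using group.inv_equality[OF group_H, of "mat 1" "mat 1"] C_one by simp
  ultimately show "subgroup {mat 1, - mat 1} H"
    by (intro subgroup.intro) (auto simp: matrix_mul_minus_left C_one C_minus)
  show "\<forall>A\<in>carrier H. {mat 1, - mat 1} #>\<^bsub>H\<^esub> A = A <#\<^bsub>H\<^esub> {mat 1, - mat 1}"
    unfolding rcoset_center by (auto simp: l_coset_def pm_def matrix_mul_minus_right)
qed

lemma group_PH: "group PH"
  unfolding PH_def by (rule normal.factorgroup_is_group[OF normal_center])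

lemma carrier_PH: "carrier PH = pm ` C"
  unfolding PH_def carrier_FactGroup rcoset_center by simp

lemma mult_PH: "A \<in> C \<Longrightarrow> B \<in> C \<Longrightarrow> pm A \<otimes>\<^bsub>PH\<^esub> pm B = pm (A ** B)"
  using normal.rcos_sum[OF normal_center, of A B] unfolding PH_def rcoset_center by simp

section \<open>Reduction of the crossing number modulo q\<close>

definition residue :: "nat \<Rightarrow> (complex^2^2) set \<Rightarrow> int" where
  "residue q X = crossing (SOME A. A \<in> X) mod int q"

text \<open>The chosen representative does not matter, because
  \<open>crossing (- A) = crossing A\<close>.\<close>

lemma residue_pm: "residue q (pm A) = crossing A mod int q"
proof -
  have "(SOME B. B \<in> pm A) \<in> pm A" by (rule someI[of _ A]) (simp add: pm_def)
  thus ?thesis by (auto simp: residue_def pm_def)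
qed

definition residue_kernel :: "nat \<Rightarrow> (complex^2^2) set set" where
  "residue_kernel q = kernel PH (integer_mod_group q) (residue q)"

lemma pm_in_kernel: "A \<in> C \<Longrightarrow> pm A \<in> residue_kernel q \<longleftrightarrow> int q dvd crossing A"
  by (auto simp: residue_kernel_def kernel_def carrier_PH residue_pm dvd_eq_mod_eq_0)

lemma group_hom_residue: assumes "q > 0"
  shows "group_hom PH (integer_mod_group q) (residue q)"
proof (intro group_hom.intro group_hom_axioms.intro group_PH group_integer_mod_group)
  show "residue q \<in> hom PH (integer_mod_group q)"
    using assms by (auto simp: hom_def carrier_PH mult_PH residue_pm crossing_mult_C
        integer_mod_group_def mod_simps)
qed

lemma normal_residue_kernel: "q > 0 \<Longrightarrow> residue_kernel q \<lhd> PH"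
  unfolding residue_kernel_def by (rule group_hom.normal_kernel[OF group_hom_residue])

lemma index_residue_kernel: assumes q: "q > 0" shows "index_of PH (residue_kernel q) = q"
proof -
  have "residue q ` carrier PH = carrier (integer_mod_group q)"
  proof
    show "residue q ` carrier PH \<subseteq> carrier (integer_mod_group q)"
      using q by (auto simp: carrier_PH residue_pm carrier_integer_mod_group)
    show "carrier (integer_mod_group q) \<subseteq> residue q ` carrier PH"
    proof
      fix n assume "n \<in> carrier (integer_mod_group q)"
      \<comment> \<open>The translation by \<open>- n w\<close> has crossing number
        \<open>n\<close>, which gives surjectivity.\<close>
      hence "residue q (pm (mat2 1 (of_int 0 + of_int (- n) * w) 0 1)) = n"
        using q unfolding residue_pm crossing_translation by (simp add: carrier_integer_mod_group)
      moreover have "mat2 1 (of_int 0 + of_int (- n) * w) 0 1 \<in> C"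
        by (rule C_translation) auto
      ultimately show "n \<in> residue q ` carrier PH" unfolding carrier_PH by (metis imageI)
    qed
  qed
  hence "PH Mod residue_kernel q \<cong> integer_mod_group q"
    unfolding residue_kernel_def by (rule group_hom.FactGroup_iso[OF group_hom_residue[OF q]])
  hence "card (carrier (PH Mod residue_kernel q)) = card (carrier (integer_mod_group q))"
    by (rule iso_same_card)
  also have "\<dots> = q" using q by (simp add: carrier_integer_mod_group)
  finally show ?thesis by (simp add: index_of_def FactGroup_def)
qed

text \<open>The kernel is normal, so only the two translations matter: the one by \<open>m\<close>
  has crossing number 0, the one by \<open>m w\<close> has \<open>- m\<close>.\<close>

lemma translation_closure_subset_iff:
  assumes "q > 0"
  shows "translation_closure PH w m \<subseteq> residue_kernel q \<longleftrightarrow> q dvd m"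
proof -
  let ?S = "{pm (mat2 1 (of_nat m) 0 1), pm (mat2 1 (of_nat m * w) 0 1)}"
  have C: "mat2 1 (of_nat m) 0 1 \<in> C" "mat2 1 (of_nat m * w) 0 1 \<in> C"
    by (auto intro: C_translation)
  have cr: "crossing (mat2 1 (of_nat m) 0 1) = 0" "crossing (mat2 1 (of_nat m * w) 0 1) = - int m"
    using crossing_translation[of "int m" 0] crossing_translation[of 0 "int m"] by simp_all
  have normal: "residue_kernel q \<lhd> PH" by (rule normal_residue_kernel[OF assms])
  show ?thesis
  proof
    assume "q dvd m"
    hence "?S \<subseteq> residue_kernel q" using pm_in_kernel C cr by simp
    hence "generate PH ?S \<subseteq> residue_kernel q"
      by (rule group.generate_subgroup_incl[OF group_PH _ normal_imp_subgroup[OF normal]])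
    thus "translation_closure PH w m \<subseteq> residue_kernel q"
      using normal by (auto simp: translation_closure_def normal_closure_def)
  next
    assume sub: "translation_closure PH w m \<subseteq> residue_kernel q"
    have "pm (mat2 1 (of_nat m * w) 0 1) \<in> generate PH ?S" by (rule generate.incl) simp
    hence "pm (mat2 1 (of_nat m * w) 0 1) \<in> translation_closure PH w m"
      by (auto simp: translation_closure_def normal_closure_def)
    thus "q dvd m" using sub pm_in_kernel[OF C(2)] cr by auto
  qed
qed

lemma has_level_residue_kernel: "q > 0 \<Longrightarrow> has_level PH w (residue_kernel q) q"
  unfolding has_level_def by (auto simp: translation_closure_subset_iff intro: dvd_imp_le)

text \<open>A nonzero ideal contains the norm \<open>N > 0\<close> of one of its nonzero elements,
  and a matrix of \<open>C\<close> congruent to the identity modulo \<open>N\<close> can have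
  crossing number prime to \<open>q\<close>.\<close>

lemma not_congruence_residue_kernel:
  fixes q :: nat
  assumes q: "prime q" and "inert_in d q \<or> q \<ge> 5"
  shows "\<not> congruence_subgroup d PH (residue_kernel q)"
proof
  assume "congruence_subgroup d PH (residue_kernel q)"
  then obtain I where I: "ideal I (O_ring d)" "I \<noteq> {0}"
    and sub: "principal_congruence PH I \<subseteq> residue_kernel q"
    by (auto simp: congruence_subgroup_def)
  interpret ideal I "O_ring d" by (rule I(1))
  have "0 \<in> I" using additive_subgroup.zero_closed[OF ideal.axioms(1)[OF I(1)]]
    by (simp add: O_ring_def)
  then obtain x where x: "x \<in> I" "x \<noteq> 0" using I(2) by blast
  have xO: "x \<in> Od" using Icarr[OF x(1)] by (simp add: O_ring_def)
  obtain N where N: "x * cnj x = of_int N" using O_norm[OF xO] by blast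
  have "of_real ((cmod x)\<^sup>2) = complex_of_real (of_int N)" unfolding complex_norm_square N by simp
  hence "(cmod x)\<^sup>2 = of_int N" by (simp only: of_real_eq_iff)
  hence N0: "N > 0" using x(2) by (metis norm_eq_zero of_int_0_less_iff zero_less_power2)
  have "of_int N \<in> I" using I_r_closed[OF x(1), of "cnj x"] xO N by (simp add: O_ring_def)
  hence NI: "z * of_int N \<in> I" if "z \<in> Od" for z
    using I_l_closed[of "of_int N" z] that by (simp add: O_ring_def)
  obtain r a b where r: "r \<in> Od" "r * cnj r = of_int a" "(r\<^sup>2 - 1) * cnj (r\<^sup>2 - 1) = of_int b"
    "\<not> int q dvd a" "\<not> int q dvd b"
    using exists_unit_mod_prime[OF assms] by blast
  have "prime (int q)" using q by simp
  then obtain A where A: "A \<in> C" "\<forall>i j. \<exists>z\<in>Od. A $ i $ j - mat 1 $ i $ j = z * of_int N"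
    "\<not> int q dvd crossing A"
    using congruent_one_crossing_not_dvd[OF N0 _ r] by blast
  have "mat_cong A (mat 1) I" unfolding mat_cong_def
  proof (intro allI)
    fix i j
    obtain z where "z \<in> Od" "A $ i $ j - mat 1 $ i $ j = z * of_int N" using A(2) by blast
    thus "A $ i $ j - mat 1 $ i $ j \<in> I" using NI by simp
  qed
  hence "pm A \<in> principal_congruence PH I"
    using A(1) by (auto simp: principal_congruence_def carrier_PH pm_def)
  hence "int q dvd crossing A" using sub pm_in_kernel[OF A(1)] by blast
  thus False using A(3) by contradiction
qed

lemma noncongruence_subgroup_exists:
  fixes q :: nat
  assumes "prime q" "inert_in d q \<or> q \<ge> 5"
  shows "\<exists>K. K \<lhd> PH \<and> \<not> congruence_subgroup d PH K \<and> has_level PH w K q \<and> index_of PH K = q"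
  using assms normal_residue_kernel not_congruence_residue_kernel has_level_residue_kernel
    index_residue_kernel prime_gt_0_nat by metis

end

section \<open>The two groups as instances of one construction\<close>

theorem proposition5p3:
  fixes d :: int and w :: complex and q :: nat
  assumes "d < 0" and "squarefree d" and "d \<noteq> -1" and "d \<noteq> -3"
    and "integral_basis_1 d w"
    and "prime q"
    and "inert_in d q \<or> (q \<ge> 5 \<and> split_in d q)"
  shows "(\<exists>K. K \<lhd> Bianchi d \<and> \<not> congruence_subgroup d (Bianchi d) K \<and>
              has_level (Bianchi d) w K q \<and> index_of (Bianchi d) K = q) \<and>
         (\<exists>K. K \<lhd> PE2 d w \<and> \<not> congruence_subgroup d (PE2 d w) K \<and>
              has_level (PE2 d w) w K q \<and> index_of (PE2 d w) K = q)"
proof -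
  note props = integral_basis_properties[OF assms(1-5)]
  obtain t n0 where tn: "w + cnj w = of_int t" "w * cnj w = of_int n0"
    using props by blast
  interpret imaginary_order d w t n0
    using integers_of_basis[OF assms(5)] props(1) tn by unfold_locales
  let ?gens = "{mat2 1 1 0 1, mat2 1 w 0 1, mat2 0 1 (-1) 0}"
  have gens: "?gens \<subseteq> carrier (SL2 d)" by simp
  have B: "elementary_overgroup d w t n0 (carrier (SL2 d))"
    by (intro elementary_overgroup.intro elementary_overgroup_axioms.intro imaginary_order_axioms
        group.subgroup_self[OF group_SL2]) (use gens in auto)
  have E: "elementary_overgroup d w t n0 (generate (SL2 d) ?gens)"
    by (intro elementary_overgroup.intro elementary_overgroup_axioms.intro imaginary_order_axioms
        group.generate_is_subgroup[OF group_SL2 gens]) (auto intro: generate.incl)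
  have q: "inert_in d q \<or> q \<ge> 5" using assms(7) by blast
  \<comment> \<open>Replacing the carrier of \<open>SL2 d\<close> by itself changes nothing, so the
    quotient is literally \<open>Bianchi d\<close>.\<close>
  have PB: "elementary_overgroup.PH d (carrier (SL2 d)) = Bianchi d"
    unfolding elementary_overgroup.PH_def[OF B] elementary_overgroup.H_def[OF B] Bianchi_def
    by (simp add: SL2_def del: SL2_simps)
  have PE: "elementary_overgroup.PH d (generate (SL2 d) ?gens) = PE2 d w"
    unfolding elementary_overgroup.PH_def[OF E] elementary_overgroup.H_def[OF E] PE2_def E2_def ..
  show ?thesis
    using elementary_overgroup.noncongruence_subgroup_exists[OF B assms(6) q, unfolded PB]
      elementary_overgroup.noncongruence_subgroup_exists[OF E assms(6) q, unfolded PE] by blast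
qed

end
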